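(* Let $H=(X,E)$ be a hypergraph with $m=|E|$ and $n=|X|$, let $DC$ be a set of acyclic degree constraints on $H$, and let $x_1,\dots,x_n$ be an order on $X$ compatible with $DC$. Let $\mathcal{C}_H(DC)$ be the class of join queries on hypergraph $H$ satisfying $DC$. Then for every $Q\in\mathcal{C}_H(DC)$ on domain $D\subseteq[2^b]$, the call $\mathsf{WCJ}(\widetilde{Q}^b,\langle\rangle)$, run with the variable order $x_1^1,\dots,x_1^b,\dots,x_n^1,\dots,x_n^b$, returns $\mathsf{ans}(Q)$ (each answer being given by its binary encoding) in time $\tilde{\mathcal{O}}(mn\cdot \mathsf{wc}(\mathcal{C}_H(DC)))$.
   Context: **Join queries.** For finite sets $X$ (variables) and $D$ (domain), $D^X$ is the set of maps (tuples) $X\to D$; $\langle\rangle$ is the empty tuple; $\tau\cup\langle x\gets d\rangle$ extends $\tau$ by mapping the new variable $x$ to $d$. For $\tau\in D^Y$, $\tau_{|Z}$ is the restriction of $\tau$ to $Y\cap Z$. A relation $R$ is a finite subset of $D^{X_R}$, where $X_R$ is its set of variables. $R_{|Y}=\{\tau_{|Y\cap X_R}:\tau\in R\}$. For $\tau\in D^Y$, $R[\tau]=\{\sigma_{|X_R\setminus Y}:\sigma\in R,\ \sigma_{|Y}=\tau_{|X_R}\}$. A join query $Q$ over variables $X$ and domain $D$ is a finite set of relations $R\subseteq D^{X_R}$ with $X_R\subseteq X$; its hypergraph is $(X,\{X_R: R\in Q\})$. $\mathsf{ans}(Q)=\{\tau\in D^X:\tau_{|X_R}\in R\text{ for all }R\in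 Q\}$ and $Q[\tau]=\{R[\tau]:R\in Q\}$. For a class $\mathcal{C}$ of join queries, $\mathsf{wc}(\mathcal{C})=\sup_{Q\in\mathcal{C}}|\mathsf{ans}(Q)|$. **Degree constraints.** A degree constraint on $H=(X,E)$ is a triple $(A,B,N_{B|A})$ with $A\subseteq B\subseteq X$ and $N_{B|A}$ a positive integer. A relation $R$ with $X_R\supseteq B$ respects it if $\max_{\tau\in D^A}|R[\tau]_{|B}|\le N_{B|A}$. Each $\delta=(A,B,N_{B|A})\in DC$ comes with a hyperedge $e_\delta\in E$, $e_\delta\supseteq B$, called its guard. $\mathcal{C}_H(DC)$ is the class of join queries $Q$ on hypergraph $H$ such that for every $\delta\in DC$ there is $R\in Q$ with $X_R=e_\delta$ that respects $\delta$. It is assumed that $\mathsf{wc}(\mathcal{C}_H(DC))<\infty$. The dependency graph $G_{DC}$ has vertex set $X$ and an edge $u\to v$ iff some $(A,B,N_{B|A})\in DC$ has $u\in A$ and $v\in B\setminus A$. $DC$ is acyclic if $G_{DC}$ is acyclic, and an order on $X$ is compatible with $DC$ if it is a topological sort of $G_{DC}$. **Binarisation.** For $k\in[2^b]=\{1,\dots,2^b\}$, $\widetilde{k}^b\in\{0,1\}^b$ is its $b$-bit binary encoding (an injective map), with $i$-th bit $\widetilde{k}^b[i]$. For a set $Y$ of variables, $\widetilde{Y}^b=\{y^i:y\in Y,1\le i\le b\}$ consists of $b$ distinct copies of each variable. For $\tau\in D^Y$, $\widetilde{\tau}^b\in\{0,1\}^{\widetilde{Y}^b}$ is given by $\widetilde{\tau}^b(y^i)=\widetilde{\tau(y)}^b[i]$.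 $\widetilde{R}^b=\{\widetilde{\tau}^b:\tau\in R\}$ and $\widetilde{Q}^b=\{\widetilde{R}^b:R\in Q\}$, a join query over $\widetilde{X}^b$ and domain $\{0,1\}$, whose answers are in bijection with $\mathsf{ans}(Q)$ via $\tau\mapsto\widetilde\tau^b$. **Algorithm.** Given a join query over ordered variables $z_1,\dots,z_p$ and domain $\Delta$, $\mathsf{WCJ}(Q,\tau)$ does the following: if $Q[\tau]$ contains an empty relation, return; otherwise let $i$ be the index of the last variable assigned by $\tau$ ($i=0$ if $\tau=\langle\rangle$); if $i=p$, output $\tau$ and return; otherwise, for each $d\in\Delta$, call $\mathsf{WCJ}(Q,\tau\cup\langle z_{i+1}\gets d\rangle)$. **Complexity conventions.** $D$ is the active domain of $Q$ (the values occurring in its relations), and values are encoded with $b=\mathcal{O}(\log|D|)$ bits. The notation $\tilde{\mathcal{O}}(\cdot)$ hides polylogarithmic factors in the relation sizes (in $\sum_{R\in Q}|R|$ and $|D|$, hence factors polynomial in $b$) and polynomial factors in the query size, which is considered constant; $\tilde{\mathcal{O}}(g)$ is read as $\tilde{\mathcal{O}}(\max(1,g))$. The relations of the query on which $\mathsf{WCJ}$ is run are assumed to be given sorted lexicographically with respect to the variable order used. *)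

theory Defs
  imports Complex_Main "HOL-Library.Extended_Nat" "HOL-Library.List_Lexorder"
begin

section \<open>Join queries\<close>

text \<open>A tuple in \<open>D\<^sup>X\<close> is a partial map with domain exactly \<open>X\<close>. A relation carries its
  set of variables explicitly, since the empty set of tuples does not determine it.\<close>

type_synonym ('v, 'd) tuple = "'v \<Rightarrow> 'd option"

datatype ('v, 'd) relation = Relation (scope: "'v set") (tups: "('v, 'd) tuple set")

datatype ('v, 'd) join_query =
  Join_Query (variables: "'v set") (domain: "'d set") (relations: "('v, 'd) relation set")

definition tuples :: "'v set \<Rightarrow> 'd set \<Rightarrow> ('v, 'd) tuple set" where
  "tuples X D = {\<tau>. dom \<tau> = X \<and> ran \<tau> \<subseteq> D}"

definition join_query :: "('v, 'd) join_query \<Rightarrow> bool" where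
  "join_query Q \<longleftrightarrow> finite (variables Q) \<and> finite (domain Q) \<and> finite (relations Q) \<and>
     (\<forall>R\<in>relations Q. scope R \<subseteq> variables Q \<and> tups R \<subseteq> tuples (scope R) (domain Q))"

definition restrict_rel :: "('v, 'd) relation \<Rightarrow> 'v set \<Rightarrow> ('v, 'd) relation" where
  "restrict_rel R Y = Relation (scope R \<inter> Y) ((\<lambda>\<sigma>. \<sigma> |` Y) ` tups R)"

text \<open>\<open>R[\<tau>]\<close> and \<open>Q[\<tau>]\<close>.\<close>

definition subst_rel :: "('v, 'd) relation \<Rightarrow> ('v, 'd) tuple \<Rightarrow> ('v, 'd) relation" where
  "subst_rel R \<tau> = Relation (scope R - dom \<tau>)
     ((\<lambda>\<sigma>. \<sigma> |` (scope R - dom \<tau>)) ` {\<sigma> \<in> tups R. \<sigma> |` dom \<tau> = \<tau> |` scope R})"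

definition subst_query :: "('v, 'd) join_query \<Rightarrow> ('v, 'd) tuple \<Rightarrow> ('v, 'd) relation set" where
  "subst_query Q \<tau> = (\<lambda>R. subst_rel R \<tau>) ` relations Q"

definition ans :: "('v, 'd) join_query \<Rightarrow> ('v, 'd) tuple set" where
  "ans Q = {\<tau> \<in> tuples (variables Q) (domain Q). \<forall>R\<in>relations Q. \<tau> |` scope R \<in> tups R}"

definition wc :: "('v, 'd) join_query set \<Rightarrow> enat" where
  "wc C = (SUP Q\<in>C. enat (card (ans Q)))"


section \<open>Degree constraints\<close>

definition hypergraph :: "'v set \<Rightarrow> 'v set set \<Rightarrow> bool" where
  "hypergraph X E \<longleftrightarrow> finite X \<and> E \<subseteq> Pow X"

type_synonym 'v degree_constraint = "'v set \<times> 'v set \<times> nat"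

text \<open>\<open>guard \<delta>\<close> is the hyperedge \<open>e\<^sub>\<delta>\<close> attached to the constraint \<open>\<delta>\<close>.\<close>

definition degree_constraints ::
  "'v set \<Rightarrow> 'v set set \<Rightarrow> 'v degree_constraint set \<Rightarrow> ('v degree_constraint \<Rightarrow> 'v set) \<Rightarrow> bool" where
  "degree_constraints X E DC guard \<longleftrightarrow>
     (\<forall>(A, B, N)\<in>DC. A \<subseteq> B \<and> B \<subseteq> X \<and> 0 < N \<and> guard (A, B, N) \<in> E \<and> B \<subseteq> guard (A, B, N))"

definition satisfies :: "'d set \<Rightarrow> ('v, 'd) relation \<Rightarrow> 'v degree_constraint \<Rightarrow> bool" where
  "satisfies D R = (\<lambda>(A, B, N). B \<subseteq> scope R \<and>
     (\<forall>\<tau>\<in>tuples A D. card (tups (restrict_rel (subst_rel R \<tau>) B)) \<le> N))"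

text \<open>The class of join queries on \<open>(X, E)\<close> satisfying \<open>DC\<close>. The domain of a query is an
  arbitrary finite set of natural numbers, so up to renaming of values every finite domain
  is covered.\<close>

definition degree_class ::
  "'v set \<Rightarrow> 'v set set \<Rightarrow> 'v degree_constraint set \<Rightarrow> ('v degree_constraint \<Rightarrow> 'v set) \<Rightarrow>
   ('v, nat) join_query set" where
  "degree_class X E DC guard =
     {Q. join_query Q \<and> variables Q = X \<and> scope ` relations Q = E \<and>
         (\<forall>\<delta>\<in>DC. \<exists>R\<in>relations Q. scope R = guard \<delta> \<and> satisfies (domain Q) R \<delta>)}"

definition dependency_graph :: "'v degree_constraint set \<Rightarrow> ('v \<times> 'v) set" where
  "dependency_graph DC = {(u, v). \<exists>(A, B, N)\<in>DC. u \<in> A \<and> v \<in> B - A}"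

definition compatible_order :: "'v set \<Rightarrow> 'v degree_constraint set \<Rightarrow> 'v list \<Rightarrow> bool" where
  "compatible_order X DC xs \<longleftrightarrow> distinct xs \<and> set xs = X \<and>
     (\<forall>(u, v)\<in>dependency_graph DC. \<exists>i j. i < j \<and> j < length xs \<and> xs ! i = u \<and> xs ! j = v)"


section \<open>Binarisation\<close>

text \<open>The \<open>b\<close>-bit encoding of \<open>k \<in> {1..2 ^ b}\<close> is the binary expansion of \<open>k - 1\<close>;
  its bits are numbered from 1 to \<open>b\<close>, most significant first. The copy \<open>y\<^sup>i\<close> of a
  variable \<open>y\<close> is the pair \<open>(y, i)\<close>.\<close>

definition code_bit :: "nat \<Rightarrow> nat \<Rightarrow> nat \<Rightarrow> nat" where
  "code_bit b k i = (k - 1) div 2 ^ (b - i) mod 2"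

definition bin_vars :: "nat \<Rightarrow> 'v set \<Rightarrow> ('v \<times> nat) set" where
  "bin_vars b Y = Y \<times> {1..b}"

definition bin_tuple :: "nat \<Rightarrow> ('v, nat) tuple \<Rightarrow> ('v \<times> nat, nat) tuple" where
  "bin_tuple b \<tau> = (\<lambda>(y, i). if i \<in> {1..b} then map_option (\<lambda>k. code_bit b k i) (\<tau> y) else None)"

definition bin_rel :: "nat \<Rightarrow> ('v, nat) relation \<Rightarrow> ('v \<times> nat, nat) relation" where
  "bin_rel b R = Relation (bin_vars b (scope R)) (bin_tuple b ` tups R)"

definition bin_query :: "nat \<Rightarrow> ('v, nat) join_query \<Rightarrow> ('v \<times> nat, nat) join_query" where
  "bin_query b Q = Join_Query (bin_vars b (variables Q)) {0, 1} (bin_rel b ` relations Q)"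

definition bin_order :: "nat \<Rightarrow> 'v list \<Rightarrow> ('v \<times> nat) list" where
  "bin_order b xs = concat (map (\<lambda>x. map (Pair x) [1..<Suc b]) xs)"


section \<open>The algorithm\<close>

text \<open>The index (counted from 1) of the last variable of \<open>zs\<close> assigned by \<open>\<tau>\<close>, and 0 if
  there is none.\<close>

definition last_assigned :: "'v list \<Rightarrow> ('v, 'd) tuple \<Rightarrow> nat" where
  "last_assigned zs \<tau> = Max (insert 0 {Suc i |i. i < length zs \<and> zs ! i \<in> dom \<tau>})"

text \<open>\<open>wcj zs Q \<tau>\<close> is the sequence of tuples output by the call \<open>WCJ(Q, \<tau>)\<close>, the
  variables of \<open>Q\<close> being ordered as in \<open>zs\<close>. Lists are indexed from 0, so \<open>zs ! i\<close> is
  \<open>z\<^bsub>i+1\<^esub>\<close>.\<close>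

function wcj :: "'v list \<Rightarrow> ('v, 'd::linorder) join_query \<Rightarrow> ('v, 'd) tuple \<Rightarrow> ('v, 'd) tuple list" where
  "wcj zs Q \<tau> =
     (if \<exists>R\<in>subst_query Q \<tau>. tups R = {} then []
      else let i = last_assigned zs \<tau> in
        if i = length zs then [\<tau>]
        else concat (map (\<lambda>d. wcj zs Q (\<tau>(zs ! i \<mapsto> d))) (sorted_list_of_set (domain Q))))"
  by pat_completeness auto

lemma last_assigned_le: "last_assigned zs \<tau> \<le> length zs"
  unfolding last_assigned_def by (rule Max.boundedI) auto

lemma last_assigned_upd:
  assumes "i < length zs"
  shows "i < last_assigned zs (\<tau>(zs ! i \<mapsto> d))"
proof -
  have "Suc i \<le> last_assigned zs (\<tau>(zs ! i \<mapsto> d))"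
    unfolding last_assigned_def by (rule Max_ge) (use assms in auto)
  then show ?thesis by simp
qed

termination wcj
proof (relation "measure (\<lambda>(zs, Q, \<tau>). length zs - last_assigned zs \<tau>)", goal_cases)
  case (2 zs Q \<tau> i d)
  then have "i < length zs" using last_assigned_le[of zs \<tau>] by simp
  with last_assigned_upd[OF this, of \<tau> d] 2 show ?case by simp
qed simp

declare wcj.simps [simp del]


section \<open>Running time\<close>

text \<open>Every function below returns its result together with the number of elementary steps
  taken, on a random access machine: lists stand for arrays, so \<open>xs ! i\<close> is one array access,
  and index arithmetic and comparisons of values take constant time.

  A relation is given as the array of its rows, sorted lexicographically with respect to the
  variable order \<open>zs\<close>. Hence for a tuple \<open>\<tau>\<close> assigning an initial segment of \<open>zs\<close>, the rows
  agreeing with \<open>\<tau>\<close> form an interval \<open>lo..<hi\<close> of that array, which represents \<open>R[\<tau>]\<close>;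
  \<open>depth\<close> is the number of columns already assigned.\<close>

record ('v, 'd) cursor =
  cols :: "'v list"
  rows :: "'d list list"
  depth :: nat
  lo :: nat
  hi :: nat

definition open_rel :: "'v list \<Rightarrow> ('v, 'd::linorder) relation \<Rightarrow> ('v, 'd) cursor" where
  "open_rel zs R =
     (let cs = filter (\<lambda>z. z \<in> scope R) zs;
          rs = sorted_list_of_set ((\<lambda>\<sigma>. map (\<lambda>z. the (\<sigma> z)) cs) ` tups R)
      in \<lparr>cols = cs, rows = rs, depth = 0, lo = 0, hi = length rs\<rparr>)"

text \<open>The least index in \<open>l..<h\<close> satisfying the monotone predicate \<open>P\<close> (\<open>h\<close> if there is none).\<close>

function bsearch :: "(nat \<Rightarrow> bool) \<Rightarrow> nat \<Rightarrow> nat \<Rightarrow> nat \<times> nat" where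
  "bsearch P l h =
     (if h \<le> l then (l, 1)
      else let m = (l + h) div 2;
               (r, t) = (if P m then bsearch P l m else bsearch P (Suc m) h)
           in (r, Suc t))"
  by pat_completeness auto
termination by (relation "measure (\<lambda>(P, l, h). h - l)") auto

declare bsearch.simps [simp del]

text \<open>From \<open>R[\<tau>]\<close> to \<open>R[\<tau> \<union> \<langle>z \<leftarrow> d\<rangle>]\<close>.\<close>

definition refine :: "'v \<Rightarrow> 'd::linorder \<Rightarrow> ('v, 'd) cursor \<Rightarrow> ('v, 'd) cursor \<times> nat" where
  "refine z d C =
     (if depth C < length (cols C) \<and> cols C ! depth C = z
      then let (l, s) = bsearch (\<lambda>j. d \<le> rows C ! j ! depth C) (lo C) (hi C);
               (h, t) = bsearch (\<lambda>j. d < rows C ! j ! depth C) l (hi C)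
           in (C\<lparr>depth := Suc (depth C), lo := l, hi := h\<rparr>, 1 + s + t)
      else (C, 1))"

text \<open>The execution of a call of the algorithm on the tuple \<open>\<tau>\<close>, where the first argument lists
  the variables not yet assigned and the cursors represent \<open>Q[\<tau>]\<close>. A call pays one step plus
  one step per relation for the emptiness test, one step per assigned variable when it outputs
  \<open>\<tau>\<close>, and otherwise, for each value \<open>d\<close>, one step for extending \<open>\<tau>\<close>, the cost of
  refining all cursors and the cost of the recursive call.\<close>

primrec exec_wcj ::
  "'v list \<Rightarrow> 'd::linorder list \<Rightarrow> ('v, 'd) tuple \<Rightarrow> ('v, 'd) cursor list \<Rightarrow>
   ('v, 'd) tuple list \<times> nat" where
  "exec_wcj [] ds \<tau> Cs =
     (if \<exists>C\<in>set Cs. hi C \<le> lo C then ([], 1 + length Cs)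
      else ([\<tau>], 1 + length Cs + card (dom \<tau>)))"
| "exec_wcj (z # zs) ds \<tau> Cs =
     (if \<exists>C\<in>set Cs. hi C \<le> lo C then ([], 1 + length Cs)
      else let runs = map (\<lambda>d.
                 let refined = map (refine z d) Cs;
                     (out, t) = exec_wcj zs ds (\<tau>(z \<mapsto> d)) (map fst refined)
                 in (out, 1 + sum_list (map snd refined) + t)) ds
           in (concat (map fst runs), 1 + length Cs + sum_list (map snd runs)))"

text \<open>The execution of \<open>WCJ(Q, \<langle>\<rangle>)\<close>, where \<open>Rs\<close> is an enumeration of the relations of \<open>Q\<close>,
  including one step per relation for setting up the cursors.\<close>

definition run_wcj ::
  "'v list \<Rightarrow> ('v, 'd::linorder) join_query \<Rightarrow> ('v, 'd) relation list \<Rightarrow>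
   ('v, 'd) tuple list \<times> nat" where
  "run_wcj zs Q Rs =
     (let (out, t) = exec_wcj zs (sorted_list_of_set (domain Q)) Map.empty (map (open_rel zs) Rs)
      in (out, length Rs + t))"

definition data_size :: "('v, 'd) join_query \<Rightarrow> nat" where
  "data_size Q = (\<Sum>R\<in>relations Q. card (tups R))"

definition query_size :: "('v, 'd) join_query \<Rightarrow> nat" where
  "query_size Q = 1 + card (variables Q) + (\<Sum>R\<in>relations Q. 1 + card (scope R))"

text \<open>A running time is soft-\<open>O\<close> of \<open>g\<close> iff it is at most \<open>soft_bound c k b Q g\<close> for
  constants \<open>c\<close> and \<open>k\<close>. Values are encoded with \<open>b\<close> bits, where \<open>b\<close> is of the order of the
  logarithm of the domain size, so the hidden polylogarithmic factors are polynomials in \<open>b\<close>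
  and in the logarithm of the size of the relations.\<close>

definition soft_bound :: "real \<Rightarrow> nat \<Rightarrow> nat \<Rightarrow> ('v, 'd) join_query \<Rightarrow> real \<Rightarrow> real" where
  "soft_bound c k b Q g =
     c * (1 + real b + log 2 (1 + real (data_size Q))) ^ k * real (query_size Q) ^ k * max 1 g"

end

theory Submission
  imports Defs
begin

text \<open>A call of the algorithm is on a tuple \<open>\<tau>\<close> assigning a prefix of the bits
  \<open>x\<^sub>1\<^sup>1, \<dots>, x\<^sub>n\<^sup>b\<close>, that is, all bits of \<open>x\<^sub>1, \<dots>, x\<^bsub>i-1\<^esub>\<close> and the first \<open>j\<close> bits of \<open>x\<^sub>i\<close>.
  The tuples at this level that are consistent with each relation separately are answers of the
  query obtained by dropping the other bits from all tuples of \<open>Q\<close>. Because the order is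
  compatible with the degree constraints, that query still satisfies them, so every level has at
  most \<open>wc\<close> consistent tuples. There are \<open>n b + 1\<close> levels, every consistent tuple causes at
  most two further calls, and each call costs a logarithmic number of steps per relation.\<close>

text \<open>A consistent tuple need not extend to an answer of \<open>Q\<close>, so the answers of
  \<open>Q\<close> itself do not bound the number of calls. Another member of the same class does:
  \<open>Q\<close> with its values truncated at the current cut. It stays in the class because a cut
  goes through a single variable. In a constraint \<open>(A, B, N)\<close>, every variable of
  \<open>B - A\<close> comes after every variable of \<open>A\<close>. If all variables of
  \<open>A\<close> are complete, the key is known exactly, and truncation can only merge tuples of
  its fibre. Otherwise some variable of \<open>A\<close> has lost bits, hence all of
  \<open>B - A\<close> lies beyond the cut and is truncated to a constant: each fibre has at most
  one tuple, and \<open>N\<close> is at least 1. Inconsistent calls are not counted by any such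
  query. Every call except the first has a consistent parent, so they cost a factor of the domain
  size, which binarisation reduces to 2. Finiteness of \<open>wc\<close> also forces the hyperedges
  to cover \<open>X\<close>. Hence answers take values of the active domain only, and the factor
  \<open>card E * card X\<close> is positive unless \<open>X\<close> is empty.\<close>

lemma finite_tuples: "finite X \<Longrightarrow> finite D \<Longrightarrow> finite (tuples X D)"
  unfolding tuples_def by (rule finite_set_of_finite_maps)

lemma tuples_SomeD: "\<sigma> \<in> tuples Y D \<Longrightarrow> \<sigma> v = Some k \<Longrightarrow> k \<in> D"
  by (auto simp: tuples_def intro: ranI)

lemma tups_SomeD:
  "join_query Q \<Longrightarrow> R \<in> relations Q \<Longrightarrow> \<rho> \<in> tups R \<Longrightarrow> \<rho> v = Some k \<Longrightarrow> k \<in> domain Q"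
  unfolding join_query_def by (meson subsetD tuples_SomeD)

lemma restrict_in_tuples: "\<sigma> \<in> tuples Y D \<Longrightarrow> A \<subseteq> Y \<Longrightarrow> \<sigma> |` A \<in> tuples A D"
  by (auto simp: tuples_def dest!: ran_restrictD intro: ranI)

lemma finite_ans: "join_query Q \<Longrightarrow> finite (ans Q)"
  unfolding ans_def join_query_def by (auto intro: finite_subset[OF _ finite_tuples])

lemma finite_tups: "join_query Q \<Longrightarrow> R \<in> relations Q \<Longrightarrow> finite (tups R)"
  unfolding join_query_def by (meson finite_subset finite_tuples)

lemma dom_tups: "join_query Q \<Longrightarrow> R \<in> relations Q \<Longrightarrow> \<sigma> \<in> tups R \<Longrightarrow> dom \<sigma> = scope R"
  unfolding join_query_def tuples_def by blast

lemma tuples_upd: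
  "\<tau> \<in> tuples Y D \<Longrightarrow> d \<in> D \<Longrightarrow> z \<notin> Y \<Longrightarrow> \<tau>(z \<mapsto> d) \<in> tuples (insert z Y) D"
  unfolding tuples_def by (auto simp: ran_def)

section \<open>Consistency of partial tuples\<close>

text \<open>This is the test made by WCJ. Different relations may have different witnesses
  \<open>\<sigma>\<close>, which need not agree outside \<open>dom \<tau>\<close>.\<close>

definition consistent :: "('v, 'd) join_query \<Rightarrow> ('v, 'd) tuple \<Rightarrow> bool" where
  "consistent Q \<tau> \<longleftrightarrow> (\<forall>R\<in>relations Q. \<exists>\<sigma>\<in>tups R. \<sigma> |` dom \<tau> = \<tau> |` scope R)"

definition partial_answers :: "('v, 'd) join_query \<Rightarrow> 'v set \<Rightarrow> ('v, 'd) tuple set" where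
  "partial_answers Q Y = {\<tau> \<in> tuples Y (domain Q). consistent Q \<tau>}"

lemma empty_subst_query_iff:
  "(\<exists>R\<in>subst_query Q \<tau>. tups R = {}) \<longleftrightarrow> \<not> consistent Q \<tau>"
  unfolding subst_query_def subst_rel_def consistent_def by auto

text \<open>Pruning is safe: no answer lies above an inconsistent tuple.\<close>

lemma consistent_if_le_ans:
  assumes "\<sigma> \<in> ans Q" "\<tau> \<subseteq>\<^sub>m \<sigma>"
  shows "consistent Q \<tau>"
  unfolding consistent_def
proof
  fix R assume "R \<in> relations Q"
  then have "\<sigma> |` scope R \<in> tups R" using assms by (auto simp: ans_def)
  moreover have "(\<sigma> |` scope R) |` dom \<tau> = \<tau> |` scope R"
    using assms(2) by (fastforce simp: map_le_def restrict_map_def)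
  ultimately show "\<exists>\<sigma>\<in>tups R. \<sigma> |` dom \<tau> = \<tau> |` scope R" by blast
qed

text \<open>Once all variables are assigned, a witness has nothing left to choose: its scope lies
  inside \<open>dom \<tau>\<close>, so it is the restriction of \<open>\<tau>\<close>
  itself.\<close>

lemma partial_answers_variables:
  assumes "join_query Q"
  shows "partial_answers Q (variables Q) = ans Q"
proof -
  have "\<tau> \<in> ans Q" if \<tau>: "\<tau> \<in> tuples (variables Q) (domain Q)" and c: "consistent Q \<tau>" for \<tau>
  proof -
    have "\<tau> |` scope R \<in> tups R" if R: "R \<in> relations Q" for R
    proof -
      obtain \<sigma> where \<sigma>: "\<sigma> \<in> tups R" "\<sigma> |` dom \<tau> = \<tau> |` scope R"
        using c R by (auto simp: consistent_def)
      have "dom \<sigma> \<subseteq> dom \<tau>"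
        using dom_tups[OF assms R \<sigma>(1)] assms R \<tau> by (auto simp: join_query_def tuples_def)
      then have "\<sigma> |` dom \<tau> = \<sigma>"
        by (auto simp: restrict_map_def fun_eq_iff domIff) (metis domIff in_mono)
      then show ?thesis using \<sigma> by simp
    qed
    then show ?thesis using \<tau> by (simp add: ans_def)
  qed
  then show ?thesis
    using consistent_if_le_ans[OF _ map_le_refl] by (auto simp: partial_answers_def ans_def)
qed

subsection \<open>Correctness of WCJ\<close>

text \<open>WCJ recovers its position from the tuple alone. This turns the position into a split
  \<open>pre @ suf\<close> of the order, on which the later inductions run.\<close>

lemma last_assigned_prefix:
  assumes "distinct (pre @ suf)" "dom \<tau> = set pre"
  shows "last_assigned (pre @ suf) \<tau> = length pre"
proof -
  have "(pre @ suf) ! i \<in> dom \<tau> \<longleftrightarrow> i < length pre" if "i < length (pre @ suf)" for i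
  proof (cases "i < length pre")
    case True then show ?thesis using assms by (simp add: nth_append)
  next
    case False
    then have "(pre @ suf) ! i \<in> set suf" using that by (simp add: nth_append)
    then show ?thesis using False assms by auto
  qed
  then have "{Suc i |i. i < length (pre @ suf) \<and> (pre @ suf) ! i \<in> dom \<tau>} = Suc ` {..<length pre}"
    by auto
  moreover have "Max (insert 0 (Suc ` {..<n})) = n" for n
    by (cases n) (auto intro!: Max_eqI)
  ultimately show ?thesis unfolding last_assigned_def by simp
qed

lemma wcj_inconsistent: "\<not> consistent Q \<tau> \<Longrightarrow> wcj zs Q \<tau> = []"
  by (subst wcj.simps) (simp add: empty_subst_query_iff)

lemma wcj_leaf:
  assumes "distinct zs" "dom \<tau> = set zs" "consistent Q \<tau>"
  shows "wcj zs Q \<tau> = [\<tau>]"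
  using assms last_assigned_prefix[of zs "[]" \<tau>]
  by (subst wcj.simps) (simp add: empty_subst_query_iff)

lemma wcj_step:
  assumes "distinct (pre @ z # suf)" "dom \<tau> = set pre" "consistent Q \<tau>"
  shows "wcj (pre @ z # suf) Q \<tau> =
    concat (map (\<lambda>d. wcj (pre @ z # suf) Q (\<tau>(z \<mapsto> d))) (sorted_list_of_set (domain Q)))"
  using last_assigned_prefix[OF assms(1,2)] assms(3)
  by (subst wcj.simps) (simp add: empty_subst_query_iff)

lemma map_le_iff_upd:
  assumes "\<tau> z = None"
  shows "\<tau>(z \<mapsto> d) \<subseteq>\<^sub>m \<sigma> \<longleftrightarrow> \<tau> \<subseteq>\<^sub>m \<sigma> \<and> \<sigma> z = Some d"
  using assms by (auto simp: map_le_def)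

lemma wcj_correct:
  assumes "join_query Q" "distinct (pre @ suf)" "set (pre @ suf) = variables Q"
    and "\<tau> \<in> tuples (set pre) (domain Q)"
  shows "distinct (wcj (pre @ suf) Q \<tau>) \<and> set (wcj (pre @ suf) Q \<tau>) = {\<sigma>\<in>ans Q. \<tau> \<subseteq>\<^sub>m \<sigma>}"
  using assms
proof (induction suf arbitrary: pre \<tau>)
  case Nil
  have dom: "dom \<tau> = variables Q" using Nil.prems by (simp add: tuples_def)
  show ?case
  proof (cases "consistent Q \<tau>")
    case True
    then have "\<tau> \<in> ans Q"
      using Nil.prems partial_answers_variables[OF Nil.prems(1)] by (auto simp: partial_answers_def)
    moreover have "\<sigma> = \<tau>" if "\<sigma> \<in> ans Q" "\<tau> \<subseteq>\<^sub>m \<sigma>" for \<sigma>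
      using that dom by (auto simp: ans_def tuples_def map_le_def fun_eq_iff) (metis domIff)
    ultimately show ?thesis
      using wcj_leaf[of pre \<tau> Q] True Nil.prems dom by auto
  next
    case False
    then show ?thesis using consistent_if_le_ans by (auto simp: wcj_inconsistent)
  qed
next
  case (Cons z suf)
  show ?case
  proof (cases "consistent Q \<tau>")
    case False
    then show ?thesis using consistent_if_le_ans by (auto simp: wcj_inconsistent)
  next
    case True
    let ?W = "\<lambda>d. wcj (pre @ z # suf) Q (\<tau>(z \<mapsto> d))"
    have z: "z \<notin> set pre" using Cons.prems(2) by auto
    then have \<tau>z: "\<tau> z = None" using Cons.prems(4) by (auto simp: tuples_def domIff)
    have IH: "distinct (?W d) \<and> set (?W d) = {\<sigma>\<in>ans Q. \<tau>(z \<mapsto> d) \<subseteq>\<^sub>m \<sigma>}" if "d \<in> domain Q" for d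
      using Cons.IH[of "pre @ [z]" "\<tau>(z \<mapsto> d)"] Cons.prems tuples_upd[OF Cons.prems(4) that z]
      by (simp del: fun_upd_apply)
    have fin: "finite (domain Q)" using Cons.prems(1) by (simp add: join_query_def)
    have eq: "wcj (pre @ z # suf) Q \<tau> = concat (map ?W (sorted_list_of_set (domain Q)))"
      using Cons.prems True by (intro wcj_step) (auto simp: tuples_def)
    \<comment> \<open>Outputs of different branches differ at \<open>z\<close>, so concatenating
      them creates no repetition.\<close>
    have dist: "distinct (concat (map f ds))"
      if "distinct ds" "\<And>d. d \<in> set ds \<Longrightarrow> distinct (f d)"
        "\<And>d \<sigma>. d \<in> set ds \<Longrightarrow> \<sigma> \<in> set (f d) \<Longrightarrow> \<sigma> z = Some d" for ds and f :: "'b \<Rightarrow> ('a \<Rightarrow> 'b option) list"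
      using that
    proof (induction ds)
      case (Cons d ds)
      have "distinct (concat (map f ds))" by (rule Cons.IH) (use Cons.prems in auto)
      moreover have "set (f d) \<inter> set (concat (map f ds)) = {}"
      proof (rule ccontr)
        assume "set (f d) \<inter> set (concat (map f ds)) \<noteq> {}"
        then obtain \<sigma> d' where "\<sigma> \<in> set (f d)" "d' \<in> set ds" "\<sigma> \<in> set (f d')" by auto
        moreover from this have "\<sigma> z = Some d" "\<sigma> z = Some d'"
          using Cons.prems(3)[of d \<sigma>] Cons.prems(3)[of d' \<sigma>] by simp_all
        ultimately show False using Cons.prems(1) by simp
      qed
      ultimately show ?case using Cons.prems(2) by simp
    qed simp
    have "distinct (wcj (pre @ z # suf) Q \<tau>)"
      unfolding eq by (rule dist) (use IH fin \<tau>z in \<open>auto simp: map_le_iff_upd\<close>)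
    moreover have "set (wcj (pre @ z # suf) Q \<tau>) = {\<sigma>\<in>ans Q. \<tau> \<subseteq>\<^sub>m \<sigma>}"
    proof -
      \<comment> \<open>Every answer picks some value at \<open>z\<close>, hence is found in one of
        the branches.\<close>
      have "\<exists>d\<in>domain Q. \<sigma> z = Some d" if "\<sigma> \<in> ans Q" for \<sigma>
      proof -
        have "z \<in> dom \<sigma>" "ran \<sigma> \<subseteq> domain Q"
          using that Cons.prems(3) by (auto simp: ans_def tuples_def)
        then show ?thesis by (auto simp: ran_def)
      qed
      then show ?thesis unfolding eq using IH fin \<tau>z by (auto simp: map_le_iff_upd)
    qed
    ultimately show ?thesis by blast
  qed
qed

subsection \<open>Cursors\<close>

text \<open>Monotonicity is asked for inside \<open>l..<h\<close> only: the next column is sorted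
  among the rows that agree with the current tuple, not in the whole array.\<close>

lemma bsearch_correct:
  assumes "l \<le> h" "\<And>i j. l \<le> i \<Longrightarrow> i \<le> j \<Longrightarrow> j < h \<Longrightarrow> P i \<Longrightarrow> P j"
  shows "l \<le> fst (bsearch P l h) \<and> fst (bsearch P l h) \<le> h \<and>
    (\<forall>j\<in>{l..<h}. P j \<longleftrightarrow> fst (bsearch P l h) \<le> j)"
  using assms
proof (induction P l h rule: bsearch.induct)
  case (1 P l h)
  show ?case
  proof (cases "h \<le> l")
    case True
    then have "bsearch P l h = (l, 1)" by (subst bsearch.simps) simp
    then show ?thesis using True 1(3) by simp
  next
    case False
    define m where "m = (l + h) div 2"
    have m: "l \<le> m" "m < h" using False by (auto simp: m_def)
    show ?thesis
    proof (cases "P m")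
      case True
      then have eq: "fst (bsearch P l h) = fst (bsearch P l m)"
        using False by (subst bsearch.simps) (simp add: m_def Let_def split_beta)
      have IH: "l \<le> fst (bsearch P l m) \<and> fst (bsearch P l m) \<le> m \<and>
        (\<forall>j\<in>{l..<m}. P j \<longleftrightarrow> fst (bsearch P l m) \<le> j)"
      proof (rule 1(1)[OF False m_def True m(1)])
        show "P j" if "l \<le> i" "i \<le> j" "j < m" "P i" for i j
          using 1(4)[of i j] that m(2) by simp
      qed
      have "P j" if "m \<le> j" "j < h" for j using 1(4)[OF m(1) that] True by simp
      then have "P j \<longleftrightarrow> fst (bsearch P l m) \<le> j" if "j \<in> {l..<h}" for j
        using IH that by (cases "j < m") auto
      then show ?thesis unfolding eq using IH m by auto
    next
      case nP: False
      then have eq: "fst (bsearch P l h) = fst (bsearch P (Suc m) h)"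
        using False by (subst bsearch.simps) (simp add: m_def Let_def split_beta)
      have IH: "Suc m \<le> fst (bsearch P (Suc m) h) \<and> fst (bsearch P (Suc m) h) \<le> h \<and>
        (\<forall>j\<in>{Suc m..<h}. P j \<longleftrightarrow> fst (bsearch P (Suc m) h) \<le> j)"
      proof (rule 1(2)[OF False m_def nP])
        show "P j" if "Suc m \<le> i" "i \<le> j" "j < h" "P i" for i j
          using 1(4)[of i j] that m(1) by simp
      qed (use m(2) in simp)
      have "\<not> P j" if "l \<le> j" "j \<le> m" for j using 1(4)[OF that m(2)] nP by auto
      then have "P j \<longleftrightarrow> fst (bsearch P (Suc m) h) \<le> j" if "j \<in> {l..<h}" for j
        using IH that by (cases "j \<le> m") auto
      then show ?thesis unfolding eq using IH m by auto
    qed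
  qed
qed

text \<open>In exponential form, one more step on half the interval is a doubling, and no logarithm
  enters the induction. The 2 is the single step on an empty interval, the 4 the two steps on an
  interval of length one.\<close>

lemma bsearch_time_power: "2 ^ snd (bsearch P l h) \<le> max 2 (4 * (h - l))"
proof (induction P l h rule: bsearch.induct)
  case (1 P l h)
  show ?case
  proof (cases "h \<le> l")
    case True
    then have "bsearch P l h = (l, 1)" by (subst bsearch.simps) simp
    then show ?thesis by simp
  next
    case False
    define m where "m = (l + h) div 2"
    show ?thesis
    proof (cases "P m")
      case True
      have "snd (bsearch P l h) = Suc (snd (bsearch P l m))"
        using False True by (subst bsearch.simps) (simp add: m_def Let_def split_beta)
      moreover have "2 ^ snd (bsearch P l m) \<le> max 2 (4 * (m - l))"
        by (rule 1(1)[OF False m_def True])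
      moreover have "2 * max 2 (4 * (m - l)) \<le> max 2 (4 * (h - l))"
        using False by (auto simp: m_def max_def)
      ultimately show ?thesis by simp
    next
      case nP: False
      have "snd (bsearch P l h) = Suc (snd (bsearch P (Suc m) h))"
        using False nP by (subst bsearch.simps) (simp add: m_def Let_def split_beta)
      moreover have "2 ^ snd (bsearch P (Suc m) h) \<le> max 2 (4 * (h - Suc m))"
        by (rule 1(2)[OF False m_def nP])
      moreover have "2 * max 2 (4 * (h - Suc m)) \<le> max 2 (4 * (h - l))"
        using False by (auto simp: m_def max_def)
      ultimately show ?thesis by simp
    qed
  qed
qed

lemma bsearch_time:
  assumes "h - l \<le> s"
  shows "real (snd (bsearch P l h)) \<le> 2 + log 2 (1 + real s)"
proof -
  have "2 ^ snd (bsearch P l h) \<le> 4 * (1 + s)"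
    using bsearch_time_power[of P l h] assms by (auto simp: max_def split: if_splits)
  then have "real (2 ^ snd (bsearch P l h)) \<le> real (4 * (1 + s))"
    by (simp only: of_nat_le_iff)
  then have "log 2 (2 ^ snd (bsearch P l h)) \<le> log 2 (4 * (1 + real s))"
    by (subst log_le_cancel_iff) auto
  also have "\<dots> = log 2 (2 ^ 2) + log 2 (1 + real s)"
    by (subst log_mult) auto
  also have "log 2 ((2::real) ^ 2) = 2" by (subst log_nat_power) auto
  finally show ?thesis by (simp add: log_nat_power)
qed

text \<open>The reason for lexicographic sorting: among rows with the same first \<open>d\<close>
  columns, column \<open>d\<close> is sorted, so it can be searched.\<close>

lemma nth_mono_of_lexord:
  fixes xs ys :: "'a::linorder list"
  assumes "xs \<le> ys" "take d xs = take d ys" "d < length xs" "d < length ys"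
  shows "xs ! d \<le> ys ! d"
  using assms
proof (induction d arbitrary: xs ys)
  case 0
  then show ?case by (cases xs; cases ys) auto
next
  case (Suc d)
  then show ?case by (cases xs; cases ys) auto
qed

section \<open>Cursors as intervals of sorted rows\<close>

text \<open>The loop invariant of the execution. Rows are never copied or shortened;
  \<open>R[\<tau>]\<close> is the interval of full rows whose assigned columns agree with
  \<open>\<tau>\<close>. An empty \<open>R[\<tau>]\<close> may be any pair with
  \<open>hi C \<le> lo C\<close>.\<close>

definition represents ::
  "'v list \<Rightarrow> 'v list \<Rightarrow> ('v, 'd::linorder) tuple \<Rightarrow> ('v, 'd) relation \<Rightarrow> ('v, 'd) cursor \<Rightarrow> bool" where
  "represents zs pre \<tau> R C \<longleftrightarrow>
     cols C = filter (\<lambda>z. z \<in> scope R) zs \<and> rows C = rows (open_rel zs R) \<and>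
     depth C = length (filter (\<lambda>z. z \<in> scope R) pre) \<and> hi C \<le> length (rows C) \<and>
     (\<forall>j<length (rows C). lo C \<le> j \<and> j < hi C \<longleftrightarrow>
        take (depth C) (rows C ! j) = map (\<lambda>z. the (\<tau> z)) (filter (\<lambda>z. z \<in> scope R) pre))"

lemma set_rows_open_rel:
  assumes "finite (tups R)"
  shows "set (rows (open_rel zs R)) = (\<lambda>\<sigma>. map (\<lambda>z. the (\<sigma> z)) (filter (\<lambda>z. z \<in> scope R) zs)) ` tups R"
  using assms by (simp add: open_rel_def Let_def)

lemma sorted_rows_open_rel: "sorted (rows (open_rel zs R))"
  by (simp add: open_rel_def Let_def)

lemma length_rows_open_rel: "finite (tups R) \<Longrightarrow> length (rows (open_rel zs R)) \<le> card (tups R)"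
  by (simp add: open_rel_def Let_def card_image_le)

lemma represents_open_rel: "represents zs [] Map.empty R (open_rel zs R)"
  by (simp add: represents_def open_rel_def Let_def)

lemma represents_nonempty_iff:
  assumes rep: "represents (pre @ suf) pre \<tau> R C" and fin: "finite (tups R)"
    and dom: "\<And>\<sigma>. \<sigma> \<in> tups R \<Longrightarrow> dom \<sigma> = scope R" "dom \<tau> = set pre"
  shows "lo C < hi C \<longleftrightarrow> (\<exists>\<sigma>\<in>tups R. \<sigma> |` dom \<tau> = \<tau> |` scope R)"
proof -
  let ?f = "filter (\<lambda>z. z \<in> scope R)"
  have len: "hi C \<le> length (rows C)" and
    int: "\<And>j. j < length (rows C) \<Longrightarrow> lo C \<le> j \<and> j < hi C \<longleftrightarrow>
      take (depth C) (rows C ! j) = map (\<lambda>z. the (\<tau> z)) (?f pre)"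
    using rep by (auto simp: represents_def)
  have "lo C < hi C \<longleftrightarrow> (\<exists>j<length (rows C). lo C \<le> j \<and> j < hi C)"
    using len by (meson le_less_trans less_le_trans order_refl)
  also have "\<dots> \<longleftrightarrow> (\<exists>r\<in>set (rows C). take (depth C) r = map (\<lambda>z. the (\<tau> z)) (?f pre))"
  proof
    assume "\<exists>j<length (rows C). lo C \<le> j \<and> j < hi C"
    then show "\<exists>r\<in>set (rows C). take (depth C) r = map (\<lambda>z. the (\<tau> z)) (?f pre)"
      using int nth_mem by blast
  next
    assume "\<exists>r\<in>set (rows C). take (depth C) r = map (\<lambda>z. the (\<tau> z)) (?f pre)"
    then obtain j where "j < length (rows C)"
      "take (depth C) (rows C ! j) = map (\<lambda>z. the (\<tau> z)) (?f pre)"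
      by (metis in_set_conv_nth)
    then show "\<exists>j<length (rows C). lo C \<le> j \<and> j < hi C" using int by blast
  qed
  \<comment> \<open>The columns follow the order \<open>pre @ suf\<close>, so the first
    \<open>depth C\<close> entries of the row of \<open>\<sigma>\<close> are its values on the
    variables of \<open>pre\<close> in the scope.\<close>
  also have "\<dots> \<longleftrightarrow> (\<exists>\<sigma>\<in>tups R. map (\<lambda>z. the (\<sigma> z)) (?f pre) = map (\<lambda>z. the (\<tau> z)) (?f pre))"
    using rep set_rows_open_rel[OF fin, of "pre @ suf"] by (simp add: represents_def)
  \<comment> \<open>Both restrictions have domain \<open>set pre \<inter> scope R\<close>, so they
    are equal iff the values agree there.\<close>
  also have "\<dots> \<longleftrightarrow> (\<exists>\<sigma>\<in>tups R. \<sigma> |` dom \<tau> = \<tau> |` scope R)"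
  proof (rule bex_cong[OF refl])
    fix \<sigma> assume "\<sigma> \<in> tups R"
    then have \<sigma>: "dom \<sigma> = scope R" using dom by simp
    have "map (\<lambda>z. the (\<sigma> z)) (?f pre) = map (\<lambda>z. the (\<tau> z)) (?f pre) \<longleftrightarrow>
        (\<forall>z\<in>set pre \<inter> scope R. \<sigma> z = \<tau> z)"
    proof -
      have "the (\<sigma> z) = the (\<tau> z) \<longleftrightarrow> \<sigma> z = \<tau> z" if "z \<in> set pre \<inter> scope R" for z
        using that \<sigma> dom(2) by (metis IntD1 IntD2 domIff option.expand)
      then show ?thesis by auto
    qed
    also have "\<dots> \<longleftrightarrow> \<sigma> |` dom \<tau> = \<tau> |` scope R"
    proof
      assume *: "\<forall>z\<in>set pre \<inter> scope R. \<sigma> z = \<tau> z"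
      have "(\<sigma> |` dom \<tau>) x = (\<tau> |` scope R) x" for x
      proof -
        have "\<tau> x = None \<longleftrightarrow> x \<notin> set pre" "\<sigma> x = None \<longleftrightarrow> x \<notin> scope R"
          using \<sigma> dom(2) by auto
        then show ?thesis using * dom(2) by (auto simp: restrict_map_def)
      qed
      then show "\<sigma> |` dom \<tau> = \<tau> |` scope R" by blast
    next
      assume "\<sigma> |` dom \<tau> = \<tau> |` scope R"
      then show "\<forall>z\<in>set pre \<inter> scope R. \<sigma> z = \<tau> z"
        using dom(2) by (metis IntE restrict_in)
    qed
    finally show "map (\<lambda>z. the (\<sigma> z)) (?f pre) = map (\<lambda>z. the (\<tau> z)) (?f pre) \<longleftrightarrow>
        \<sigma> |` dom \<tau> = \<tau> |` scope R" .
  qed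
  finally show ?thesis .
qed

text \<open>The rows with value \<open>d\<close> in the next column lie between the first entry at
  least \<open>d\<close> and the first entry above \<open>d\<close>. A relation without
  \<open>z\<close> keeps its cursor. Nonemptiness makes the first search well formed; refinement
  happens only at consistent tuples, where it holds.\<close>

lemma represents_refine:
  assumes rep: "represents (pre @ z # suf) pre \<tau> R C" and fin: "finite (tups R)"
    and dist: "distinct (pre @ z # suf)" and ne: "lo C < hi C"
  shows "represents (pre @ z # suf) (pre @ [z]) (\<tau>(z \<mapsto> d)) R (fst (refine z d C))"
proof -
  let ?f = "filter (\<lambda>z. z \<in> scope R)"
  let ?rs = "rows C" and ?k = "depth C"
  have cols: "cols C = ?f (pre @ z # suf)" and depth: "?k = length (?f pre)"
    and rs: "?rs = rows (open_rel (pre @ z # suf) R)" and len: "hi C \<le> length ?rs"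
    and int: "\<And>j. j < length ?rs \<Longrightarrow> lo C \<le> j \<and> j < hi C \<longleftrightarrow>
      take ?k (?rs ! j) = map (\<lambda>z. the (\<tau> z)) (?f pre)"
    using rep by (auto simp: represents_def)
  have upd: "map (\<lambda>y. the ((\<tau>(z \<mapsto> d)) y)) (?f pre) = map (\<lambda>y. the (\<tau> y)) (?f pre)"
    using dist by auto
  show ?thesis
  proof (cases "z \<in> scope R")
    case False
    have "\<not> (?k < length (cols C) \<and> cols C ! ?k = z)"
    proof
      assume "?k < length (cols C) \<and> cols C ! ?k = z"
      then have "z \<in> set (cols C)" using nth_mem by blast
      then show False using False cols by simp
    qed
    then have "fst (refine z d C) = C" unfolding refine_def by (simp only: if_False fst_conv)
    then show ?thesis
      using rep False unfolding represents_def
      by (elim conjE) (simp add: upd del: fun_upd_apply map_eq_conv)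
  next
    case True
    \<comment> \<open>Exactly the scope variables of \<open>pre\<close> precede \<open>z\<close>
      among the columns.\<close>
    then have here: "?k < length (cols C)" "cols C ! ?k = z"
      by (simp_all add: cols depth nth_append)
    have row_len: "?k < length (?rs ! j)" if "j < length ?rs" for j
    proof -
      have "?rs ! j \<in> set ?rs" using that by simp
      then have "length (?rs ! j) = length (cols C)"
        using set_rows_open_rel[OF fin, of "pre @ z # suf"] rs cols by auto
      then show ?thesis using here by simp
    qed
    have mono: "?rs ! i ! ?k \<le> ?rs ! j ! ?k" if "lo C \<le> i" "i \<le> j" "j < hi C" for i j
    proof (rule nth_mono_of_lexord)
      show "?rs ! i \<le> ?rs ! j"
        using sorted_rows_open_rel[of "pre @ z # suf" R] rs that len by (simp add: sorted_iff_nth_mono)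
      show "take ?k (?rs ! i) = take ?k (?rs ! j)"
        using int[of i] int[of j] that len by simp
    qed (use row_len that len in auto)
    define P1 where "P1 = (\<lambda>j. d \<le> ?rs ! j ! ?k)"
    define P2 where "P2 = (\<lambda>j. d < ?rs ! j ! ?k)"
    define l where "l = fst (bsearch P1 (lo C) (hi C))"
    define h where "h = fst (bsearch P2 l (hi C))"
    have "lo C \<le> l \<and> l \<le> hi C \<and> (\<forall>j\<in>{lo C..<hi C}. P1 j \<longleftrightarrow> l \<le> j)"
      unfolding l_def
    proof (rule bsearch_correct)
      show "P1 j" if "lo C \<le> i" "i \<le> j" "j < hi C" "P1 i" for i j
        using mono[OF that(1-3)] that(4) by (simp add: P1_def)
    qed (use ne in simp)
    then have l: "lo C \<le> l" "l \<le> hi C"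
      "\<And>j. lo C \<le> j \<Longrightarrow> j < hi C \<Longrightarrow> d \<le> ?rs ! j ! ?k \<longleftrightarrow> l \<le> j"
      by (auto simp: P1_def)
    have "l \<le> h \<and> h \<le> hi C \<and> (\<forall>j\<in>{l..<hi C}. P2 j \<longleftrightarrow> h \<le> j)"
      unfolding h_def
    proof (rule bsearch_correct)
      show "P2 j" if "l \<le> i" "i \<le> j" "j < hi C" "P2 i" for i j
        using mono[OF order_trans[OF l(1) that(1)] that(2,3)] that(4) by (simp add: P2_def)
    qed (rule l(2))
    then have h: "l \<le> h" "h \<le> hi C"
      "\<And>j. l \<le> j \<Longrightarrow> j < hi C \<Longrightarrow> d < ?rs ! j ! ?k \<longleftrightarrow> h \<le> j"
      by (auto simp: P2_def)
    have fst_refine: "fst (refine z d C) = C\<lparr>depth := Suc ?k, lo := l, hi := h\<rparr>"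
      using here by (simp add: refine_def split_beta Let_def l_def h_def P1_def P2_def)
    have "l \<le> j \<and> j < h \<longleftrightarrow> take (Suc ?k) (?rs ! j) = map (\<lambda>y. the (\<tau> y)) (?f pre) @ [d]"
      if j: "j < length ?rs" for j
    proof -
      have "take (Suc ?k) (?rs ! j) = map (\<lambda>y. the (\<tau> y)) (?f pre) @ [d] \<longleftrightarrow>
          take ?k (?rs ! j) = map (\<lambda>y. the (\<tau> y)) (?f pre) \<and> ?rs ! j ! ?k = d"
        using row_len[OF j] by (simp add: take_Suc_conv_app_nth)
      also have "\<dots> \<longleftrightarrow> lo C \<le> j \<and> j < hi C \<and> ?rs ! j ! ?k = d" using int[OF j] by auto
      also have "\<dots> \<longleftrightarrow> l \<le> j \<and> j < h"
      proof (cases "lo C \<le> j \<and> j < hi C")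
        case True
        then show ?thesis using l(3)[of j] h(3)[of j] by (cases "l \<le> j") auto
      next
        case False
        then show ?thesis using l(1) h(2) by auto
      qed
      finally show ?thesis by simp
    qed
    then show ?thesis
      unfolding represents_def fst_refine using True h(2) len cols rs depth
      by (simp add: upd fun_upd_same del: fun_upd_apply map_eq_conv)
  qed
qed

lemma empty_cursor_iff_inconsistent:
  assumes "join_query Q" "set Rs = relations Q" "dom \<tau> = set pre"
    and "list_all2 (represents (pre @ suf) pre \<tau>) Rs Cs"
  shows "(\<exists>C\<in>set Cs. hi C \<le> lo C) \<longleftrightarrow> \<not> consistent Q \<tau>"
proof -
  have rep: "lo C < hi C \<longleftrightarrow> (\<exists>\<sigma>\<in>tups R. \<sigma> |` dom \<tau> = \<tau> |` scope R)"
    if "R \<in> relations Q" "represents (pre @ suf) pre \<tau> R C" for R C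
    using represents_nonempty_iff[OF that(2)] finite_tups[OF assms(1) that(1)]
      dom_tups[OF assms(1) that(1)] assms(3) by blast
  have "set Rs \<subseteq> relations Q" by (simp add: assms(2))
  with assms(4) have "(\<forall>C\<in>set Cs. lo C < hi C) \<longleftrightarrow>
      (\<forall>R\<in>set Rs. \<exists>\<sigma>\<in>tups R. \<sigma> |` dom \<tau> = \<tau> |` scope R)"
  proof (induction Rs Cs rule: list_all2_induct)
    case (Cons R Rs C Cs)
    then show ?case using rep[of R C] by auto
  qed simp
  then show ?thesis using assms(2) unfolding consistent_def by (metis linorder_not_less)
qed

lemma list_all2_represents_refine:
  assumes "join_query Q" "set Rs = relations Q" "distinct (pre @ z # suf)"
    and "list_all2 (represents (pre @ z # suf) pre \<tau>) Rs Cs" "\<forall>C\<in>set Cs. lo C < hi C"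
  shows "list_all2 (represents (pre @ z # suf) (pre @ [z]) (\<tau>(z \<mapsto> d))) Rs
    (map fst (map (refine z d) Cs))"
proof -
  have "represents (pre @ z # suf) (pre @ [z]) (\<tau>(z \<mapsto> d)) (Rs ! i) (fst (refine z d (Cs ! i)))"
    if "i < length Rs" for i
    using assms that
    by (intro represents_refine finite_tups[OF assms(1)]) (auto simp: list_all2_conv_all_nth)
  then show ?thesis using assms(4) by (simp add: list_all2_conv_all_nth del: fun_upd_apply)
qed

section \<open>Agreement of the execution with WCJ\<close>

lemma exec_wcj_output:
  assumes "join_query Q" "set Rs = relations Q" "distinct (pre @ suf)" "dom \<tau> = set pre"
    and "list_all2 (represents (pre @ suf) pre \<tau>) Rs Cs"
  shows "fst (exec_wcj suf (sorted_list_of_set (domain Q)) \<tau> Cs) = wcj (pre @ suf) Q \<tau>"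
  using assms
proof (induction suf arbitrary: pre \<tau> Cs)
  case Nil
  then show ?case
    using empty_cursor_iff_inconsistent[OF Nil.prems(1,2,4,5)] wcj_leaf[of pre \<tau> Q]
    by (simp add: wcj_inconsistent)
next
  case (Cons z suf)
  show ?case
  proof (cases "consistent Q \<tau>")
    case False
    then show ?thesis
      using empty_cursor_iff_inconsistent[OF Cons.prems(1,2,4,5)] by (simp add: wcj_inconsistent)
  next
    case True
    then have ne: "\<not> (\<exists>C\<in>set Cs. hi C \<le> lo C)"
      using empty_cursor_iff_inconsistent[OF Cons.prems(1,2,4,5)] by simp
    have "fst (exec_wcj suf (sorted_list_of_set (domain Q)) (\<tau>(z \<mapsto> d))
        (map fst (map (refine z d) Cs))) = wcj (pre @ z # suf) Q (\<tau>(z \<mapsto> d))" for d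
      using Cons.IH[of "pre @ [z]" "\<tau>(z \<mapsto> d)"] Cons.prems ne
        list_all2_represents_refine[OF Cons.prems(1,2,3,5), of d]
      by (simp add: linorder_not_le del: fun_upd_apply)
    then show ?thesis
      using ne wcj_step[OF Cons.prems(3,4) True]
      by (simp add: Let_def split_beta comp_def)
  qed
qed

subsection \<open>Running time in terms of consistent tuples\<close>

text \<open>Contains all consistent calls at or below \<open>\<tau>\<close>, level by level.
  Extensions of \<open>\<tau>\<close> are taken without following the recursion, as only an upper
  bound is wanted and each level can then be bounded on its own.\<close>

definition live :: "('v, 'd) join_query \<Rightarrow> 'v list \<Rightarrow> nat \<Rightarrow> ('v, 'd) tuple \<Rightarrow> ('v, 'd) tuple set" where
  "live Q zs p \<tau> = (\<Union>q\<in>{p..length zs}. {\<sigma> \<in> partial_answers Q (set (take q zs)). \<tau> \<subseteq>\<^sub>m \<sigma>})"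

lemma finite_partial_answers: "finite (domain Q) \<Longrightarrow> finite Y \<Longrightarrow> finite (partial_answers Q Y)"
  unfolding partial_answers_def by (auto intro: finite_subset[OF _ finite_tuples])

lemma finite_live: "finite (domain Q) \<Longrightarrow> finite (live Q zs p \<tau>)"
  unfolding live_def by (auto simp: finite_partial_answers)

text \<open>This makes the time recursion close: the branches are disjoint, being told apart by the
  value at \<open>z\<close>, and \<open>\<tau>\<close> is in none of them, so the summand 1 is free
  to pay for the current call.\<close>

lemma card_live_step:
  assumes "finite (domain Q)" "distinct (pre @ z # suf)"
    and "\<tau> \<in> tuples (set pre) (domain Q)" "consistent Q \<tau>"
  shows "1 + (\<Sum>d\<in>domain Q. card (live Q (pre @ z # suf) (Suc (length pre)) (\<tau>(z \<mapsto> d))))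
    \<le> card (live Q (pre @ z # suf) (length pre) \<tau>)"
proof -
  let ?L = "\<lambda>d. live Q (pre @ z # suf) (Suc (length pre)) (\<tau>(z \<mapsto> d))"
  have \<tau>z: "\<tau> z = None" using assms(2,3) by (auto simp: tuples_def domIff)
  have sub: "?L d \<subseteq> {\<sigma> \<in> live Q (pre @ z # suf) (length pre) \<tau>. \<sigma> z = Some d}" for d
    using \<tau>z by (force simp: live_def map_le_iff_upd)
  have \<tau>: "\<tau> \<in> live Q (pre @ z # suf) (length pre) \<tau>"
    using assms by (auto simp: live_def partial_answers_def intro!: bexI[of _ "length pre"])
  have "(\<Sum>d\<in>domain Q. card (?L d)) = card (\<Union>d\<in>domain Q. ?L d)"
  proof (intro card_UN_disjoint[symmetric] ballI impI)
    have "\<sigma> z = Some d" if "\<sigma> \<in> ?L d" for \<sigma> d using sub that by blast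
    then show "?L d \<inter> ?L d' = {}" if "d \<noteq> d'" for d d'
      using that by (metis disjoint_iff option.inject)
  qed (simp_all add: assms(1) finite_live)
  moreover have "\<tau> \<notin> (\<Union>d\<in>domain Q. ?L d)"
  proof
    assume "\<tau> \<in> (\<Union>d\<in>domain Q. ?L d)"
    then obtain d where "\<tau> \<in> ?L d" by blast
    then show False using sub[of d] \<tau>z by auto
  qed
  moreover have "finite (\<Union>d\<in>domain Q. ?L d)" using assms(1) by (simp add: finite_live)
  ultimately have "1 + (\<Sum>d\<in>domain Q. card (?L d)) = card (insert \<tau> (\<Union>d\<in>domain Q. ?L d))"
    by simp
  also have "\<dots> \<le> card (live Q (pre @ z # suf) (length pre) \<tau>)"
    using assms(1) sub \<tau> by (intro card_mono) (auto simp: finite_live)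
  finally show ?thesis .
qed

lemma refine_time:
  assumes "represents zs pre \<tau> R C" "finite (tups R)" "card (tups R) \<le> M"
    and "\<And>P l h. h - l \<le> M \<Longrightarrow> snd (bsearch P l h) \<le> t"
  shows "snd (refine z d C) \<le> 1 + 2 * t"
proof -
  have "hi C \<le> M"
    using assms(1,3) length_rows_open_rel[OF assms(2), of zs]
    unfolding represents_def by (elim conjE) simp
  then have t: "snd (bsearch P l (hi C)) \<le> t" for P l using assms(4) by simp
  show ?thesis
    by (simp add: refine_def split_beta Let_def add_mono[OF t t, simplified mult_2[symmetric]])
qed

text \<open>A consistent call pays at most \<open>L\<close> itself and issues \<open>card (domain Q)\<close> calls; an inconsistent
  one pays at most \<open>L\<close> and issues none. So the calls are counted by the consistent ones.\<close>

lemma exec_wcj_time: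
  assumes "join_query Q" "set Rs = relations Q" "distinct (pre @ suf)"
    and "\<tau> \<in> tuples (set pre) (domain Q)"
    and "list_all2 (represents (pre @ suf) pre \<tau>) Rs Cs"
    and "\<And>R. R \<in> relations Q \<Longrightarrow> card (tups R) \<le> M"
    and "\<And>P l h. h - l \<le> M \<Longrightarrow> snd (bsearch P l h) \<le> t"
    and "L = 1 + length Rs + length (pre @ suf) + card (domain Q) * (1 + length Rs * (1 + 2 * t))"
  shows "snd (exec_wcj suf (sorted_list_of_set (domain Q)) \<tau> Cs)
    \<le> L * (1 + card (domain Q) * card (live Q (pre @ suf) (length pre) \<tau>))"
  using assms(1-5,8)
proof (induction suf arbitrary: pre \<tau> Cs)
  case Nil
  have "length Cs = length Rs" using Nil.prems(5) by (simp add: list_all2_lengthD)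
  moreover have "card (dom \<tau>) \<le> length pre"
    using Nil.prems(4) by (simp add: tuples_def card_length)
  ultimately have "snd (exec_wcj [] (sorted_list_of_set (domain Q)) \<tau> Cs) \<le> L"
    using Nil.prems(6) by simp
  also have "L \<le> L * (1 + k)" for k by simp
  finally show ?case .
next
  case (Cons z suf)
  let ?D = "domain Q"
  let ?c = "\<lambda>d. card (live Q (pre @ z # suf) (Suc (length pre)) (\<tau>(z \<mapsto> d)))"
  have len: "length Cs = length Rs" using Cons.prems(5) by (simp add: list_all2_lengthD)
  have dom: "dom \<tau> = set pre" using Cons.prems(4) by (simp add: tuples_def)
  note inc = empty_cursor_iff_inconsistent[OF Cons.prems(1,2) dom Cons.prems(5)]
  show ?case
  proof (cases "consistent Q \<tau>")
    case False
    then have "snd (exec_wcj (z # suf) (sorted_list_of_set ?D) \<tau> Cs) \<le> L"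
      using inc Cons.prems(6) len by simp
    also have "L \<le> L * (1 + k)" for k by simp
    finally show ?thesis .
  next
    case True
    then have ne: "\<not> (\<exists>C\<in>set Cs. hi C \<le> lo C)" using inc by simp
    have fin: "finite ?D" using Cons.prems(1) by (simp add: join_query_def)
    have z: "z \<notin> set pre" using Cons.prems(3) by auto
    let ?r = "\<lambda>d. sum_list (map snd (map (refine z d) Cs))"
    let ?e = "\<lambda>d. snd (exec_wcj suf (sorted_list_of_set ?D) (\<tau>(z \<mapsto> d)) (map fst (map (refine z d) Cs)))"
    have r: "?r d \<le> length Rs * (1 + 2 * t)" for d
    proof -
      have "snd (refine z d C) \<le> 1 + 2 * t" if C: "C \<in> set Cs" for C
      proof -
        obtain R where R: "R \<in> relations Q" "represents (pre @ z # suf) pre \<tau> R C"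
          using C Cons.prems(2,5) by (metis in_set_conv_nth list_all2_conv_all_nth)
        show ?thesis
          by (rule refine_time[OF R(2) finite_tups[OF Cons.prems(1) R(1)] assms(6)[OF R(1)] assms(7)])
      qed
      then have "?r d \<le> sum_list (map (\<lambda>C. 1 + 2 * t) Cs)"
        unfolding map_map comp_def by (intro sum_list_mono) simp
      then show ?thesis using len by (simp add: sum_list_triv)
    qed
    have e: "?e d \<le> L * (1 + card ?D * ?c d)" if "d \<in> ?D" for d
      using Cons.IH[of "pre @ [z]" "\<tau>(z \<mapsto> d)"] Cons.prems ne
        list_all2_represents_refine[OF Cons.prems(1,2,3,5), of d] tuples_upd[OF Cons.prems(4) that z]
      by (simp add: linorder_not_le del: fun_upd_apply)
    have "snd (exec_wcj (z # suf) (sorted_list_of_set ?D) \<tau> Cs)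
        = 1 + length Cs + (\<Sum>d\<in>?D. 1 + ?r d + ?e d)"
    proof -
      have "snd (exec_wcj (z # suf) (sorted_list_of_set ?D) \<tau> Cs)
        = 1 + length Cs + sum_list (map (\<lambda>d. 1 + ?r d + ?e d) (sorted_list_of_set ?D))"
        using ne by (simp add: Let_def split_beta comp_def)
      then show ?thesis using fin by (simp add: sum_list_distinct_conv_sum_set)
    qed
    \<comment> \<open>Each child is charged \<open>L\<close> even if it is inconsistent. Together
      these charges give \<open>L * card ?D\<close>, which is the share of \<open>\<tau>\<close>
      itself in \<open>live\<close>.\<close>
    also have "\<dots> \<le> 1 + length Rs + (\<Sum>d\<in>?D. 1 + length Rs * (1 + 2 * t) + L * (1 + card ?D * ?c d))"
      using r e len by (intro add_mono sum_mono) auto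
    also have "\<dots> = 1 + length Rs + card ?D * (1 + length Rs * (1 + 2 * t))
        + L * card ?D * (1 + (\<Sum>d\<in>?D. ?c d))"
      by (simp only: sum.distrib sum_constant sum_distrib_left[symmetric] of_nat_id) (simp add: algebra_simps)
    \<comment> \<open>\<open>L\<close> was chosen to contain the emptiness test and all refinements
      of one call; its summand for the length of the order pays for the output at a leaf.\<close>
    also have "\<dots> \<le> L + L * card ?D * card (live Q (pre @ z # suf) (length pre) \<tau>)"
      using card_live_step[OF fin Cons.prems(3,4) True]
      by (intro add_mono mult_left_mono) (auto simp: Cons.prems(6))
    finally show ?thesis by (simp add: algebra_simps)
  qed
qed

lemma card_live_le:
  assumes "\<And>q. q \<le> length zs \<Longrightarrow> card (partial_answers Q (set (take q zs))) \<le> W" "finite (domain Q)"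
  shows "card (live Q zs 0 \<tau>) \<le> (length zs + 1) * W"
proof -
  have "card (live Q zs 0 \<tau>) \<le> (\<Sum>q\<in>{0..length zs}. card {\<sigma> \<in> partial_answers Q (set (take q zs)). \<tau> \<subseteq>\<^sub>m \<sigma>})"
    unfolding live_def by (rule card_UN_le) simp
  also have "\<dots> \<le> (\<Sum>q\<in>{0..length zs}. W)"
  proof (rule sum_mono)
    fix q assume "q \<in> {0..length zs}"
    then show "card {\<sigma> \<in> partial_answers Q (set (take q zs)). \<tau> \<subseteq>\<^sub>m \<sigma>} \<le> W"
      using assms(1)[of q] card_mono[OF finite_partial_answers[OF assms(2)],
          of "set (take q zs)" "{\<sigma> \<in> partial_answers Q (set (take q zs)). \<tau> \<subseteq>\<^sub>m \<sigma>}"] by auto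
  qed
  finally show ?thesis by simp
qed

subsection \<open>Binarisation and dropped bits\<close>

lemma nat_eq_if_low_bits_eq:
  fixes m n :: nat
  assumes "m < 2 ^ b" "n < 2 ^ b" "\<And>j. j < b \<Longrightarrow> m div 2 ^ j mod 2 = n div 2 ^ j mod 2"
  shows "m = n"
proof -
  have "bit (take_bit b m) j = bit (take_bit b n) j" for j
  proof -
    have "j < b \<Longrightarrow> bit m j = bit n j"
      using assms(3)[of j] by (simp add: bit_iff_odd odd_iff_mod_2_eq_one)
    then show ?thesis by (auto simp: bit_take_bit_iff)
  qed
  then have "take_bit b m = take_bit b n" by (simp add: bit_eq_iff)
  then show ?thesis using assms(1,2) by (simp add: take_bit_nat_eq_self)
qed

text \<open>Reads a block of bit variables of a tuple back as a number, adding the lowest bit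
  last.\<close>

lemma nat_with_bits_exists:
  fixes f :: "nat \<Rightarrow> nat"
  assumes "\<And>j. j < b \<Longrightarrow> f j \<in> {0, 1}"
  shows "\<exists>k<2 ^ b. \<forall>j<b. k div 2 ^ j mod 2 = f j"
  using assms
proof (induction b arbitrary: f)
  case (Suc b)
  obtain k where k: "k < 2 ^ b" "\<forall>j<b. k div 2 ^ j mod 2 = f (Suc j)"
    using Suc.IH[of "\<lambda>j. f (Suc j)"] Suc.prems by auto
  have f0: "f 0 < 2" using Suc.prems[of 0] by auto
  have "(2 * k + f 0) div 2 ^ j mod 2 = f j" if "j < Suc b" for j
  proof (cases j)
    case 0
    then show ?thesis using f0 by simp
  next
    case (Suc i)
    then have "(2 * k + f 0) div 2 ^ j = k div 2 ^ i"
      using f0 by (simp add: div_mult2_eq)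
    then show ?thesis using k Suc that by simp
  qed
  moreover have "2 * k + f 0 < 2 ^ Suc b" using k f0 by simp
  ultimately show ?case by blast
qed simp

text \<open>\<open>coarsen e\<close> drops the last \<open>e v\<close> bits of the value of \<open>v\<close>, and \<open>bits\<close> lists the
  remaining ones.\<close>

definition coarsen :: "('v \<Rightarrow> nat) \<Rightarrow> ('v, nat) tuple \<Rightarrow> ('v, nat) tuple" where
  "coarsen e \<sigma> = (\<lambda>v. map_option (\<lambda>k. (k - 1) div 2 ^ e v) (\<sigma> v))"

definition bits :: "nat \<Rightarrow> ('v \<Rightarrow> nat) \<Rightarrow> ('v, nat) tuple \<Rightarrow> ('v \<times> nat, nat) tuple" where
  "bits b e u = (\<lambda>(v, i). if 1 \<le> i \<and> i \<le> b - e v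
     then map_option (\<lambda>k. k div 2 ^ (b - e v - i) mod 2) (u v) else None)"

definition kept :: "nat \<Rightarrow> ('v \<Rightarrow> nat) \<Rightarrow> 'v set \<Rightarrow> ('v \<times> nat) set" where
  "kept b e X = {(v, i). v \<in> X \<and> 1 \<le> i \<and> i \<le> b - e v}"

text \<open>The domain changes because coarsened values start at 0. One domain serves all
  \<open>e\<close>; this is harmless since the class leaves the domain of a query free.\<close>

definition coarsen_query :: "nat \<Rightarrow> ('v \<Rightarrow> nat) \<Rightarrow> ('v, nat) join_query \<Rightarrow> ('v, nat) join_query" where
  "coarsen_query b e Q = Join_Query (variables Q) {..<2 ^ b}
     ((\<lambda>R. Relation (scope R) (coarsen e ` tups R)) ` relations Q)"

lemma dom_coarsen [simp]: "dom (coarsen e \<sigma>) = dom \<sigma>"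
  by (auto simp: coarsen_def)

lemma coarsen_in_tuples:
  assumes "\<sigma> \<in> tuples Y D" "D \<subseteq> {1..2 ^ b}"
  shows "coarsen e \<sigma> \<in> tuples Y {..<2 ^ b}"
proof -
  have "k' < 2 ^ b" if k': "coarsen e \<sigma> v = Some k'" for v k'
  proof -
    obtain k where k: "\<sigma> v = Some k" "k' = (k - 1) div 2 ^ e v"
      using k' by (auto simp: coarsen_def)
    then have "k \<in> {1..2 ^ b}" using tuples_SomeD[OF assms(1)] assms(2) by blast
    then have "k - 1 < 2 ^ b" by auto
    then show ?thesis unfolding k(2) by (rule le_less_trans[OF div_le_dividend])
  qed
  then have "ran (coarsen e \<sigma>) \<subseteq> {..<2 ^ b}" by (auto simp: ran_def)
  then show ?thesis using assms by (simp add: tuples_def)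
qed

lemma coarsen_restrict: "coarsen e \<sigma> |` Y = coarsen e (\<sigma> |` Y)"
  by (auto simp: coarsen_def restrict_map_def)

lemma bin_tuple_in_tuples: "bin_tuple b \<sigma> \<in> tuples (bin_vars b (dom \<sigma>)) {0, 1}"
  by (auto simp: tuples_def bin_tuple_def bin_vars_def ran_def code_bit_def split: if_splits)

lemma join_query_bin_query:
  assumes Q: "join_query Q"
  shows "join_query (bin_query b Q)"
proof -
  have "tups (bin_rel b R) \<subseteq> tuples (scope (bin_rel b R)) {0, 1}" if R: "R \<in> relations Q" for R
  proof -
    have "bin_tuple b \<sigma> \<in> tuples (bin_vars b (scope R)) {0, 1}" if "\<sigma> \<in> tups R" for \<sigma>
      using bin_tuple_in_tuples[of b \<sigma>] dom_tups[OF Q R that] by simp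
    then show ?thesis by (auto simp: bin_rel_def)
  qed
  moreover have "scope (bin_rel b R) \<subseteq> bin_vars b (variables Q)" if "R \<in> relations Q" for R
    using Q that by (auto simp: join_query_def bin_rel_def bin_vars_def)
  ultimately show ?thesis
    using Q by (auto simp: join_query_def bin_query_def bin_vars_def)
qed

text \<open>A tuple consistent with the first bits of each relation arises from an answer of the
  coarsened query: on each scope, equal bits force equal coarsened values.\<close>

lemma partial_answer_of_bits:
  assumes Q: "join_query Q" "domain Q \<subseteq> {1..2 ^ b}"
    and \<tau>: "\<tau> \<in> partial_answers (bin_query b Q) (kept b e (variables Q))"
  shows "\<exists>u\<in>ans (coarsen_query b e Q). \<tau> = bits b e u"
proof -
  let ?X = "variables Q"
  have dom: "dom \<tau> = kept b e ?X" and ran: "ran \<tau> \<subseteq> {0, 1}" and con: "consistent (bin_query b Q) \<tau>"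
    using \<tau> by (auto simp: partial_answers_def tuples_def bin_query_def)
  \<comment> \<open>\<open>k\<close> is the number spelled by the bits of \<open>v\<close> kept in
    \<open>\<tau>\<close>. Copies are numbered from the most significant bit, so bit
    \<open>j\<close> from below is copy \<open>b - e v - j\<close>; if no bit is kept,
    \<open>k\<close> must be 0.\<close>
  define good where "good v k \<longleftrightarrow> k < 2 ^ (b - e v) \<and>
    (\<forall>j<b - e v. k div 2 ^ j mod 2 = the (\<tau> (v, b - e v - j)))" for v k
  have the_\<tau>: "\<tau> (v, i) = Some (the (\<tau> (v, i))) \<and> the (\<tau> (v, i)) \<in> {0, 1}"
    if "v \<in> ?X" "1 \<le> i" "i \<le> b - e v" for v i
  proof -
    have "(v, i) \<in> dom \<tau>" using that dom by (simp add: kept_def)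
    then obtain y where y: "\<tau> (v, i) = Some y" by blast
    then have "y \<in> {0, 1}" using ran by (auto dest: ranI)
    then show ?thesis using y by simp
  qed
  have "\<exists>k. good v k" if "v \<in> ?X" for v
    unfolding good_def by (rule nat_with_bits_exists) (use the_\<tau>[OF that] in auto)
  then obtain w where w: "\<And>v. v \<in> ?X \<Longrightarrow> good v (w v)" by metis
  have good_unique: "k = k'" if "good v k" "good v k'" for v k k'
    using that by (intro nat_eq_if_low_bits_eq[of k "b - e v" k']) (auto simp: good_def)
  define u where "u v = (if v \<in> ?X then Some (w v) else None)" for v
  have "\<tau> x = bits b e u x" for x
  proof (cases x)
    case (Pair v i)
    show ?thesis
    proof (cases "(v, i) \<in> kept b e ?X")
      case True
      then have vi: "v \<in> ?X" "1 \<le> i" "i \<le> b - e v" by (auto simp: kept_def)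
      have "w v div 2 ^ (b - e v - i) mod 2 = the (\<tau> (v, b - e v - (b - e v - i)))"
        using w[OF vi(1)] vi by (auto simp: good_def)
      then show ?thesis using vi the_\<tau>[OF vi] Pair by (simp add: bits_def u_def)
    next
      case False
      then have "\<tau> (v, i) = None" using dom by (metis domIff)
      then show ?thesis using False Pair by (auto simp: bits_def u_def kept_def)
    qed
  qed
  then have eq: "\<tau> = bits b e u" by blast
  have w_lt: "w v < 2 ^ b" if "v \<in> ?X" for v
  proof -
    have "w v < 2 ^ (b - e v)" using w[OF that] by (simp add: good_def)
    also have "(2::nat) ^ (b - e v) \<le> 2 ^ b" by (simp add: power_increasing)
    finally show ?thesis .
  qed
  have "u \<in> tuples ?X {..<2 ^ b}"
    using w_lt by (auto simp: tuples_def u_def ran_def dom_def split: if_splits)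
  moreover have "u |` scope R \<in> coarsen e ` tups R" if R: "R \<in> relations Q" for R
  proof -
    have "bin_rel b R \<in> relations (bin_query b Q)" using R by (simp add: bin_query_def)
    then obtain \<rho> where \<rho>: "\<rho> \<in> tups R" "bin_tuple b \<rho> |` dom \<tau> = \<tau> |` bin_vars b (scope R)"
      using con by (force simp: consistent_def bin_rel_def)
    have dom_\<rho>: "dom \<rho> = scope R" using dom_tups[OF Q(1) R \<rho>(1)] .
    have sub: "scope R \<subseteq> ?X" using Q(1) R by (simp add: join_query_def)
    have "(u |` scope R) v = coarsen e \<rho> v" for v
    proof (cases "v \<in> scope R")
      case False
      then have "\<rho> v = None" using dom_\<rho> by (metis domIff)
      then show ?thesis using False by (simp add: coarsen_def)
    next
      case True
      then obtain k where k: "\<rho> v = Some k" using dom_\<rho> by auto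
      then have "k \<in> domain Q" by (rule tups_SomeD[OF Q(1) R \<rho>(1)])
      then have "k \<in> {1..2 ^ b}" using Q(2) by blast
      then have "k - 1 < 2 ^ b" by auto
      \<comment> \<open>Only an inequality, as \<open>e v\<close> may exceed \<open>b\<close> and
        the subtraction truncates.\<close>
      also have "(2::nat) ^ b \<le> 2 ^ (b - e v) * 2 ^ e v"
        by (simp add: power_add[symmetric] power_increasing)
      finally have "(k - 1) div 2 ^ e v < 2 ^ (b - e v)" by (simp add: less_mult_imp_div_less)
      moreover have "(k - 1) div 2 ^ e v div 2 ^ j mod 2 = the (\<tau> (v, b - e v - j))"
        if j: "j < b - e v" for j
      proof -
        define i where "i = b - e v - j"
        have i: "1 \<le> i" "i \<le> b - e v" "i \<le> b" "e v + j = b - i" using j by (auto simp: i_def)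
        have "(v, i) \<in> dom \<tau>" "(v, i) \<in> bin_vars b (scope R)"
          using i sub True by (auto simp: dom kept_def bin_vars_def)
        then have "bin_tuple b \<rho> (v, i) = \<tau> (v, i)" using \<rho>(2) by (metis restrict_in)
        moreover have "bin_tuple b \<rho> (v, i) = Some ((k - 1) div 2 ^ (e v + j) mod 2)"
          using i k by (auto simp: bin_tuple_def code_bit_def)
        ultimately have "the (\<tau> (v, i)) = (k - 1) div 2 ^ (e v + j) mod 2" by (metis option.sel)
        then show ?thesis unfolding i_def[symmetric] by (simp add: power_add div_mult2_eq)
      qed
      ultimately have "good v ((k - 1) div 2 ^ e v)" by (simp add: good_def)
      \<comment> \<open>Here the witnesses of different relations are glued: \<open>w\<close>
        depends on \<open>\<tau>\<close> alone, and uniqueness makes every witness agree with it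
        after coarsening.\<close>
      then have "w v = (k - 1) div 2 ^ e v" using good_unique w sub True by blast
      then show ?thesis using True sub k by (auto simp: u_def coarsen_def)
    qed
    then have "u |` scope R = coarsen e \<rho>" by blast
    then show ?thesis using \<rho>(1) by blast
  qed
  ultimately have "u \<in> ans (coarsen_query b e Q)"
    by (auto simp: ans_def coarsen_query_def)
  then show ?thesis using eq by blast
qed

section \<open>Answers of the binarised query\<close>

text \<open>Binarisation is the case where no bit is dropped, so the reconstruction for partial
  tuples also serves for full answers.\<close>

lemma bin_tuple_eq_bits: "bin_tuple b \<sigma> = bits b (\<lambda>_. 0) (coarsen (\<lambda>_. 0) \<sigma>)"
  by (auto simp: bin_tuple_def bits_def coarsen_def code_bit_def fun_eq_iff option.map_comp comp_def)

lemma inj_on_bin_tuple: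
  assumes "D \<subseteq> {1..2 ^ b}"
  shows "inj_on (bin_tuple b) (tuples X D)"
proof (rule inj_onI, rule ext)
  fix \<sigma> \<sigma>' :: "('a, nat) tuple" and v
  assume *: "\<sigma> \<in> tuples X D" "\<sigma>' \<in> tuples X D" "bin_tuple b \<sigma> = bin_tuple b \<sigma>'"
  show "\<sigma> v = \<sigma>' v"
  proof (cases "v \<in> X")
    case False
    then show ?thesis using * by (auto simp: tuples_def)
  next
    case True
    then have "v \<in> dom \<sigma>" "v \<in> dom \<sigma>'" using * by (auto simp: tuples_def)
    then obtain k k' where k: "\<sigma> v = Some k" "\<sigma>' v = Some k'" by blast
    then have kD: "k \<in> {1..2 ^ b}" "k' \<in> {1..2 ^ b}"
      using * assms tuples_SomeD by (metis subsetD)+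
    have "k - 1 = k' - 1"
    proof (rule nat_eq_if_low_bits_eq)
      fix j assume j: "j < b"
      have "bin_tuple b \<sigma> (v, b - j) = bin_tuple b \<sigma>' (v, b - j)" using * by simp
      then show "(k - 1) div 2 ^ j mod 2 = (k' - 1) div 2 ^ j mod 2"
        using j k by (simp add: bin_tuple_def code_bit_def Suc_le_eq)
    qed (use kD in auto)
    then show ?thesis using k kD by auto
  qed
qed

lemma bin_tuple_in_ans:
  assumes "\<sigma> \<in> ans Q"
  shows "bin_tuple b \<sigma> \<in> ans (bin_query b Q)"
proof -
  have "bin_tuple b \<sigma> |` bin_vars b Y = bin_tuple b (\<sigma> |` Y)" for Y
    by (auto simp: bin_tuple_def bin_vars_def restrict_map_def fun_eq_iff)
  moreover have "bin_tuple b \<sigma> \<in> tuples (bin_vars b (variables Q)) {0, 1}"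
    using assms bin_tuple_in_tuples[of b \<sigma>] by (simp add: ans_def tuples_def)
  ultimately show ?thesis
    using assms by (auto simp: ans_def bin_query_def bin_rel_def)
qed

lemma ans_bin_query:
  assumes Q: "join_query Q" "domain Q \<subseteq> {1..2 ^ b}" and cover: "variables Q \<subseteq> \<Union> (scope ` relations Q)"
  shows "ans (bin_query b Q) = bin_tuple b ` ans Q"
proof (intro subset_antisym subsetI)
  fix \<tau> assume "\<tau> \<in> ans (bin_query b Q)"
  moreover have "variables (bin_query b Q) = kept b (\<lambda>_. 0) (variables Q)"
    by (auto simp: bin_query_def kept_def bin_vars_def)
  ultimately have "\<tau> \<in> partial_answers (bin_query b Q) (kept b (\<lambda>_. 0) (variables Q))"
    using partial_answers_variables[OF join_query_bin_query[OF Q(1)]] by metis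
  then obtain u where u: "u \<in> ans (coarsen_query b (\<lambda>_. 0) Q)" "\<tau> = bits b (\<lambda>_. 0) u"
    using partial_answer_of_bits[OF Q] by blast
  \<comment> \<open>Undoes the shift by one made by \<open>coarsen\<close>; this is exact on the
    relations because their values are at least 1.\<close>
  define \<sigma> where "\<sigma> v = map_option Suc (u v)" for v
  have c: "coarsen (\<lambda>_. 0) \<sigma> = u"
    by (auto simp: coarsen_def \<sigma>_def fun_eq_iff option.map_comp comp_def option.map_ident)
  have \<sigma>R: "\<sigma> |` scope R \<in> tups R" if R: "R \<in> relations Q" for R
  proof -
    obtain \<rho> where \<rho>: "\<rho> \<in> tups R" "u |` scope R = coarsen (\<lambda>_. 0) \<rho>"
      using u(1) R by (auto simp: ans_def coarsen_query_def)
    have "\<rho> v = (\<sigma> |` scope R) v" for v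
    proof -
      have "(u |` scope R) v = map_option (\<lambda>k. k - 1) (\<rho> v)" using \<rho>(2) by (simp add: coarsen_def)
      moreover have "k \<ge> 1" if "\<rho> v = Some k" for k
      proof -
        have "k \<in> domain Q" using that by (rule tups_SomeD[OF Q(1) R \<rho>(1)])
        then show ?thesis using Q(2) by auto
      qed
      ultimately show ?thesis
        by (cases "\<rho> v"; cases "v \<in> scope R") (auto simp: \<sigma>_def)
    qed
    then have "\<rho> = \<sigma> |` scope R" by blast
    then show ?thesis using \<rho>(1) by simp
  qed
  have "dom \<sigma> = dom u" by (auto simp: \<sigma>_def)
  then have dom: "dom \<sigma> = variables Q"
    using u(1) by (simp add: ans_def coarsen_query_def tuples_def)
  \<comment> \<open>The decoded value is only known to be some \<open>b\<close>-bit number. It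
    belongs to the domain because \<open>v\<close> lies in a scope, and the tuples of that relation
    take values in the domain.\<close>
  have "k \<in> domain Q" if "\<sigma> v = Some k" for v k
  proof -
    have "v \<in> variables Q" using that dom by blast
    then obtain R where R: "R \<in> relations Q" "v \<in> scope R" using cover by blast
    then have "(\<sigma> |` scope R) v = Some k" using that by simp
    then show ?thesis by (rule tups_SomeD[OF Q(1) R(1) \<sigma>R[OF R(1)]])
  qed
  then have "\<sigma> \<in> ans Q" using \<sigma>R dom by (auto simp: ans_def tuples_def ran_def)
  moreover have "\<tau> = bin_tuple b \<sigma>" using u(2) c by (simp add: bin_tuple_eq_bits)
  ultimately show "\<tau> \<in> bin_tuple b ` ans Q" by blast
qed (auto intro: bin_tuple_in_ans)

subsection \<open>Degree constraints\<close>

text \<open>Either the fibres over \<open>A\<close> do not grow, as \<open>A\<close> keeps all bits, or \<open>B - A\<close> keeps none.\<close>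

lemma satisfies_coarsen:
  assumes sat: "satisfies D R (A, B, N)" and "A \<subseteq> B" "0 < N" and fin: "finite (tups R)"
    and R: "tups R \<subseteq> tuples (scope R) D" and D: "D \<subseteq> {1..2 ^ b}"
    and e: "(\<forall>v\<in>A. e v = 0) \<or> (\<forall>v\<in>B - A. b \<le> e v)"
  shows "satisfies D' (Relation (scope R) (coarsen e ` tups R)) (A, B, N)"
proof -
  have BR: "B \<subseteq> scope R" using sat by (simp add: satisfies_def)
  have "card (tups (restrict_rel (subst_rel (Relation (scope R) (coarsen e ` tups R)) \<tau>) B)) \<le> N"
    if \<tau>: "dom \<tau> = A" for \<tau>
  proof -
    define S where "S = tups (restrict_rel (subst_rel (Relation (scope R) (coarsen e ` tups R)) \<tau>) B)"
    have in_S: "\<exists>\<sigma>\<in>tups R. coarsen e \<sigma> |` A = \<tau> \<and> s = coarsen e (\<sigma> |` (B - A))" if "s \<in> S" for s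
    proof -
      have "\<tau> |` scope R = \<tau>"
        using \<tau> BR assms(2) by (auto simp: restrict_map_def fun_eq_iff) (metis domIff subsetD)
      moreover have "(scope R - A) \<inter> B = B - A" using BR by auto
      ultimately show ?thesis
        using that \<tau> by (auto simp: S_def restrict_rel_def subst_rel_def coarsen_restrict)
    qed
    from e have "card S \<le> N"
    proof
      assume e0: "\<forall>v\<in>A. e v = 0"
      show ?thesis
      proof (cases "S = {}")
        case False
        \<comment> \<open>Any member of the fibre reveals the original key: with no bits lost on
          \<open>A\<close>, all tuples over \<open>\<tau>\<close> agree with
          \<open>\<sigma>0\<close> there. The fibre of \<open>R\<close> over that key then maps onto
          a superset of \<open>S\<close>.\<close>
        then obtain \<sigma>0 where \<sigma>0: "\<sigma>0 \<in> tups R" "coarsen e \<sigma>0 |` A = \<tau>" using in_S by blast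
        define \<tau>0 where "\<tau>0 = \<sigma>0 |` A"
        have A: "A \<subseteq> scope R" using assms(2) BR by simp
        have \<sigma>0T: "\<sigma>0 \<in> tuples (scope R) D" using R \<sigma>0(1) by blast
        then have \<tau>0: "\<tau>0 \<in> tuples A D" unfolding \<tau>0_def using A by (rule restrict_in_tuples)
        define T where "T = tups (restrict_rel (subst_rel R \<tau>0) B)"
        have "S \<subseteq> coarsen e ` T"
        proof
          fix s assume "s \<in> S"
          then obtain \<sigma> where \<sigma>: "\<sigma> \<in> tups R" "coarsen e \<sigma> |` A = \<tau>" "s = coarsen e (\<sigma> |` (B - A))"
            using in_S by blast
          have "\<sigma> v = \<sigma>0 v" if v: "v \<in> A" for v
          proof -
            have "v \<in> dom \<sigma>" "v \<in> dom \<sigma>0" using v A \<sigma>(1) \<sigma>0(1) R by (auto simp: tuples_def)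
            then obtain k k0 where k: "\<sigma> v = Some k" "\<sigma>0 v = Some k0" by auto
            have "\<sigma> \<in> tuples (scope R) D" using \<sigma>(1) R by blast
            then have "k \<in> D" "k0 \<in> D" using tuples_SomeD k \<sigma>0T by metis+
            then have "k \<ge> 1" "k0 \<ge> 1" using D by auto
            moreover have "(coarsen e \<sigma> |` A) v = (coarsen e \<sigma>0 |` A) v" using \<sigma>(2) \<sigma>0(2) by simp
            ultimately show ?thesis using v e0 k by (simp add: coarsen_def)
          qed
          then have "\<sigma> |` A = \<tau>0" by (auto simp: \<tau>0_def restrict_map_def)
          moreover have "\<tau>0 |` scope R = \<tau>0" "dom \<tau>0 = A"
            using \<tau>0 A by (auto simp: tuples_def restrict_map_def \<tau>0_def fun_eq_iff)
          ultimately have "\<sigma> \<in> {\<rho> \<in> tups R. \<rho> |` dom \<tau>0 = \<tau>0 |` scope R}" and "dom \<tau>0 = A"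
            using \<sigma>(1) by simp_all
          then have "(\<sigma> |` (scope R - A)) |` B \<in> T"
            unfolding T_def restrict_rel_def subst_rel_def relation.sel by blast
          moreover have "(scope R - A) \<inter> B = B - A" using BR by auto
          ultimately show "s \<in> coarsen e ` T" using \<sigma>(3) by simp
        qed
        moreover have "finite T" using fin by (simp add: T_def restrict_rel_def subst_rel_def)
        ultimately have "card S \<le> card T"
          by (meson card_image_le card_mono finite_imageI le_trans)
        also have "\<dots> \<le> N" using sat \<tau>0 by (simp add: satisfies_def T_def)
        finally show ?thesis .
      qed simp
    next
      assume eb: "\<forall>v\<in>B - A. b \<le> e v"
      \<comment> \<open>Dropping at least \<open>b\<close> bits of a \<open>b\<close>-bit number
        leaves 0.\<close>
      have "S \<subseteq> {\<lambda>v. if v \<in> B - A then Some 0 else None}"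
      proof
        fix s assume "s \<in> S"
        then obtain \<sigma> where \<sigma>: "\<sigma> \<in> tups R" "s = coarsen e (\<sigma> |` (B - A))" using in_S by blast
        have "s v = (if v \<in> B - A then Some 0 else None)" for v
        proof (cases "v \<in> B - A")
          case False
          then show ?thesis unfolding \<sigma>(2) by (auto simp: coarsen_def restrict_map_def)
        next
          case True
          have \<sigma>T: "\<sigma> \<in> tuples (scope R) D" using \<sigma>(1) R by blast
          then have "v \<in> dom \<sigma>" using True BR by (auto simp: tuples_def)
          then obtain k where k: "\<sigma> v = Some k" by auto
          then have "k \<in> D" by (rule tuples_SomeD[OF \<sigma>T])
          then have "k \<in> {1..2 ^ b}" using D by blast
          then have "k - 1 < 2 ^ b" by auto
          also have "(2::nat) ^ b \<le> 2 ^ e v" using eb True by (simp add: power_increasing)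
          finally show ?thesis using True k by (simp add: \<sigma>(2) coarsen_def)
        qed
        then show "s \<in> {\<lambda>v. if v \<in> B - A then Some 0 else None}" by blast
      qed
      then have "card S \<le> 1" using card_mono[of "{\<lambda>v. if v \<in> B - A then Some 0 else None}" S] by simp
      then show ?thesis using assms(3) by simp
    qed
    then show ?thesis by (simp add: S_def)
  qed
  then show ?thesis using BR by (simp add: satisfies_def tuples_def)
qed

text \<open>Scopes are untouched, so the coarsened guard relation of a constraint is again its
  guard.\<close>

lemma coarsen_query_in_degree_class:
  assumes dc: "degree_constraints X E DC guard" and Q: "Q \<in> degree_class X E DC guard"
    and D: "domain Q \<subseteq> {1..2 ^ b}"
    and e: "\<And>A B N. (A, B, N) \<in> DC \<Longrightarrow> (\<forall>v\<in>A. e v = 0) \<or> (\<forall>v\<in>B - A. b \<le> e v)"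
  shows "coarsen_query b e Q \<in> degree_class X E DC guard"
proof -
  have jq: "join_query Q" and X: "variables Q = X" and E: "scope ` relations Q = E"
    using Q by (auto simp: degree_class_def)
  have "coarsen e ` tups R \<subseteq> tuples (scope R) {..<2 ^ b}" if "R \<in> relations Q" for R
  proof -
    have "tups R \<subseteq> tuples (scope R) (domain Q)" using that jq by (simp add: join_query_def)
    then show ?thesis using coarsen_in_tuples[OF _ D] by blast
  qed
  then have "join_query (coarsen_query b e Q)"
    using jq by (auto simp: join_query_def coarsen_query_def)
  moreover have "\<exists>R\<in>relations (coarsen_query b e Q). scope R = guard \<delta> \<and>
      satisfies (domain (coarsen_query b e Q)) R \<delta>" if \<delta>: "\<delta> \<in> DC" for \<delta>
  proof -
    obtain A B N where ABN: "\<delta> = (A, B, N)" by (cases \<delta>)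
    have AB: "A \<subseteq> B" "0 < N" using dc \<delta> ABN by (auto simp: degree_constraints_def)
    obtain R where R: "R \<in> relations Q" "scope R = guard \<delta>" "satisfies (domain Q) R \<delta>"
      using Q \<delta> by (auto simp: degree_class_def)
    have "tups R \<subseteq> tuples (scope R) (domain Q)" using jq R(1) by (simp add: join_query_def)
    then have "satisfies {..<2 ^ b} (Relation (scope R) (coarsen e ` tups R)) \<delta>"
      using satisfies_coarsen[OF R(3)[unfolded ABN] AB finite_tups[OF jq R(1)] _ D] e \<delta>
      unfolding ABN by blast
    then show ?thesis using R(1,2) by (auto simp: coarsen_query_def)
  qed
  ultimately show ?thesis
    using X E by (auto simp: degree_class_def coarsen_query_def image_image)
qed

section \<open>The worst case and degenerate hypergraphs\<close>

lemma card_ans_le_wc: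
  assumes "Q \<in> C" "wc C < \<infinity>"
  shows "card (ans Q) \<le> the_enat (wc C)"
proof -
  have "enat (card (ans Q)) \<le> wc C" unfolding wc_def using assms(1) by (rule SUP_upper)
  then show ?thesis using assms(2) by (cases "wc C") auto
qed

text \<open>Without variables the product in the time bound vanishes, and \<open>max 1 g\<close> has
  to dominate \<open>wc\<close> by itself.\<close>

lemma wc_le_one_if_no_variables: "wc (degree_class {} E DC guard) \<le> 1"
  unfolding wc_def
proof (rule SUP_least)
  fix Q :: "('a, nat) join_query" assume "Q \<in> degree_class {} E DC guard"
  then have "ans Q \<subseteq> {Map.empty}" by (auto simp: degree_class_def ans_def tuples_def)
  then have "card (ans Q) \<le> 1" using card_mono[of "{Map.empty}" "ans Q"] by simp
  then show "enat (card (ans Q)) \<le> 1" by (simp add: one_enat_def)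
qed

text \<open>A variable outside all hyperedges could take arbitrarily many values.\<close>

lemma covered_if_wc_finite:
  fixes guard :: "'v degree_constraint \<Rightarrow> 'v set"
  assumes hg: "hypergraph X E" and dc: "degree_constraints X E DC guard"
    and wc: "wc (degree_class X E DC guard) < \<infinity>"
  shows "X \<subseteq> \<Union> E"
proof (rule ccontr)
  assume "\<not> X \<subseteq> \<Union> E"
  then obtain x where x: "x \<in> X" "x \<notin> \<Union> E" by blast
  define W where "W = the_enat (wc (degree_class X E DC guard))"
  define zero :: "'v set \<Rightarrow> ('v, nat) tuple" where "zero e = (\<lambda>v. if v \<in> e then Some 0 else None)" for e
  \<comment> \<open>One tuple per relation keeps every degree at most 1, so all constraints hold.
    The domain has \<open>W + 1\<close> values, and each of them is possible at \<open>x\<close>: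
    one answer too many.\<close>
  define Q where "Q = Join_Query X {..W} ((\<lambda>e. Relation e {zero e}) ` E)"
  have EX: "finite X" "finite E" "\<And>e. e \<in> E \<Longrightarrow> e \<subseteq> X"
    using hg finite_subset[of E "Pow X"] by (auto simp: hypergraph_def)
  have "satisfies D (Relation e {zero e}) (A, B, N)" if "B \<subseteq> e" "0 < N" for D e A B N
  proof -
    have "card (tups (restrict_rel (subst_rel (Relation e {zero e}) \<tau>) B)) \<le> 1" for \<tau>
    proof -
      have "tups (restrict_rel (subst_rel (Relation e {zero e}) \<tau>) B)
          \<subseteq> {zero e |` (e - dom \<tau>) |` B}"
        by (auto simp: restrict_rel_def subst_rel_def)
      then show ?thesis using card_mono[of "{zero e |` (e - dom \<tau>) |` B}"] by fastforce
    qed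
    then show ?thesis using that by (force simp: satisfies_def intro: le_trans)
  qed
  then have "Q \<in> degree_class X E DC guard"
    using dc EX by (fastforce simp: degree_class_def Q_def join_query_def degree_constraints_def
        tuples_def zero_def ran_def dom_def image_image split: if_splits)
  then have le: "card (ans Q) \<le> W" and fin: "finite (ans Q)"
    using card_ans_le_wc[OF _ wc] by (auto simp: W_def degree_class_def finite_ans)
  define f where "f d = (zero X)(x \<mapsto> d)" for d
  have "inj_on f {..W}" by (rule inj_onI) (metis f_def fun_upd_same option.inject)
  moreover have "f ` {..W} \<subseteq> ans Q"
  proof -
    have "f d |` e = zero e" if "e \<in> E" for d e
      using x EX(3)[OF that] that by (auto simp: f_def zero_def restrict_map_def fun_eq_iff)
    moreover have "f d \<in> tuples X {..W}" if "d \<le> W" for d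
      using x that by (auto simp: f_def zero_def tuples_def ran_def dom_def split: if_splits)
    ultimately show ?thesis by (auto simp: ans_def Q_def)
  qed
  ultimately have "card {..W} \<le> card (ans Q)" using fin by (metis card_image card_mono)
  then show False using le by simp
qed

subsection \<open>The order of the bits\<close>

lemma bin_order_Cons: "bin_order b (x # xs) = map (Pair x) [1..<Suc b] @ bin_order b xs"
  by (simp add: bin_order_def)

lemma length_bin_order: "length (bin_order b xs) = length xs * b"
  by (induction xs) (simp_all add: bin_order_Cons, simp add: bin_order_def)

lemma set_bin_order: "set (bin_order b xs) = bin_vars b (set xs)"
  by (auto simp: bin_order_def bin_vars_def simp del: upt_Suc)

lemma distinct_bin_order: "distinct xs \<Longrightarrow> distinct (bin_order b xs)"
proof (induction xs)
  case (Cons x xs)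
  then show ?case
    by (auto simp: bin_order_Cons set_bin_order bin_vars_def distinct_map inj_on_def simp del: upt_Suc)
qed (simp add: bin_order_def)

text \<open>A prefix ends inside a single variable: those before it lose no bits, those after it
  lose all \<open>b\<close>. Stated for pairs, this is what an edge of the dependency graph can use,
  since it goes forward in the order.\<close>

lemma prefix_bin_order:
  assumes "distinct xs"
  shows "\<exists>e. set (take q (bin_order b xs)) = kept b e (set xs) \<and>
    sorted_wrt (\<lambda>u v. e u = 0 \<or> e v = b) xs"
  using assms
proof (induction xs arbitrary: q)
  case Nil
  then show ?case by (simp add: bin_order_def kept_def)
next
  case (Cons x xs)
  have kept_insert: "kept b e (insert x Y) = Pair x ` {1..b - e x} \<union> kept b e Y" for e Y
    by (auto simp: kept_def)
  show ?case
  proof (cases "q \<le> b")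
    case True
    \<comment> \<open>The cut falls in the block of \<open>x\<close>, which keeps its first
      \<open>q\<close> bits.\<close>
    define e where "e v = (if v = x then b - q else b)" for v
    have "set (take q (bin_order b (x # xs))) = Pair x ` {1..q}"
      using True by (auto simp: bin_order_Cons take_map simp del: upt_Suc)
    moreover have "kept b e (set xs) = {}" using Cons.prems by (auto simp: kept_def e_def)
    moreover have "sorted_wrt (\<lambda>u v. e u = 0 \<or> e v = b) (x # xs)"
      using Cons.prems by (auto simp: e_def sorted_wrt_iff_nth_less)
    moreover have "b - e x = q" using True by (simp add: e_def)
    ultimately show ?thesis by (intro exI[of _ e]) (simp add: kept_insert)
  next
    case False
    obtain e where e: "set (take (q - b) (bin_order b xs)) = kept b e (set xs)"
      "sorted_wrt (\<lambda>u v. e u = 0 \<or> e v = b) xs"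
      using Cons by auto
    define e' where "e' = e(x := 0)"
    have "set (take q (bin_order b (x # xs))) = Pair x ` {1..b} \<union> kept b e (set xs)"
      using False e by (auto simp: bin_order_Cons simp del: upt_Suc)
    moreover have "kept b e' (set xs) = kept b e (set xs)"
    proof -
      have "e' v = e v" if "v \<in> set xs" for v using that Cons.prems by (auto simp: e'_def)
      then show ?thesis by (auto simp: kept_def)
    qed
    moreover have "sorted_wrt (\<lambda>u v. e' u = 0 \<or> e' v = b) xs"
      using e(2) Cons.prems by (elim sorted_wrt_mono_rel[rotated]) (auto simp: e'_def)
    moreover have "e' x = 0" by (simp add: e'_def)
    ultimately show ?thesis by (intro exI[of _ e']) (simp add: kept_insert)
  qed
qed

section \<open>The bound per level and the total time\<close>

text \<open>The consistent tuples of a level are images under \<open>bits\<close> of answers of a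
  query in the class, so \<open>wc\<close> bounds them although they may extend to no answer of
  \<open>Q\<close>.\<close>

lemma card_partial_answers_le_wc:
  assumes dc: "degree_constraints X E DC guard" and Q: "Q \<in> degree_class X E DC guard"
    and D: "domain Q \<subseteq> {1..2 ^ b}" and wc: "wc (degree_class X E DC guard) < \<infinity>"
    and xs: "compatible_order X DC xs"
  shows "card (partial_answers (bin_query b Q) (set (take q (bin_order b xs))))
    \<le> the_enat (wc (degree_class X E DC guard))"
proof -
  have dist: "distinct xs" "set xs = X" using xs by (auto simp: compatible_order_def)
  have jq: "join_query Q" and X: "variables Q = X" using Q by (auto simp: degree_class_def)
  obtain e where e: "set (take q (bin_order b xs)) = kept b e X"
    "sorted_wrt (\<lambda>u v. e u = 0 \<or> e v = b) xs"
    using prefix_bin_order[OF dist(1)] dist(2) by blast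
  have "(\<forall>v\<in>A. e v = 0) \<or> (\<forall>v\<in>B - A. b \<le> e v)" if ABN: "(A, B, N) \<in> DC" for A B N
  proof -
    \<comment> \<open>Pairwise over \<open>A\<close> and \<open>B - A\<close>: a single incomplete
      \<open>u\<close> in \<open>A\<close> forces every \<open>v\<close> in \<open>B - A\<close> to
      lose all its bits.\<close>
    have "e u = 0 \<or> e v = b" if uv: "u \<in> A" "v \<in> B - A" for u v
    proof -
      have "(u, v) \<in> dependency_graph DC" using ABN uv by (auto simp: dependency_graph_def)
      then obtain i j where "i < j" "j < length xs" "xs ! i = u" "xs ! j = v"
        using xs by (auto simp: compatible_order_def)
      then show ?thesis using e(2) by (auto simp: sorted_wrt_iff_nth_less)
    qed
    then show ?thesis by (metis order_refl)
  qed
  then have C: "coarsen_query b e Q \<in> degree_class X E DC guard"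
    by (rule coarsen_query_in_degree_class[OF dc Q D])
  then have fin: "finite (ans (coarsen_query b e Q))" by (auto simp: degree_class_def finite_ans)
  have "partial_answers (bin_query b Q) (kept b e X) \<subseteq> bits b e ` ans (coarsen_query b e Q)"
    using partial_answer_of_bits[OF jq D] X by blast
  then have "card (partial_answers (bin_query b Q) (kept b e X)) \<le> card (ans (coarsen_query b e Q))"
    using fin by (meson card_image_le card_mono finite_imageI le_trans)
  then show ?thesis using card_ans_le_wc[OF C wc] e(1) by simp
qed

lemma card_relations_bin_query: "join_query Q \<Longrightarrow> card (relations (bin_query b Q)) \<le> card (relations Q)"
  by (simp add: bin_query_def join_query_def card_image_le)

text \<open>With \<open>S\<close> the query size and \<open>P\<close> the logarithmic factor, a call
  costs at most \<open>15 * (S * P)\<close>, and the calls are covered by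
  \<open>3 * (S * P * g)\<close>, one factor \<open>S * P\<close> coming from the number of levels.
  The product has constant 45 and exponent 2; setting up the cursors adds 1 to the constant.\<close>

lemma run_wcj_time:
  fixes Q :: "('v, nat) join_query"
  assumes hg: "hypergraph X E" and dc: "degree_constraints X E DC guard"
    and wc: "wc (degree_class X E DC guard) < \<infinity>" and xs: "compatible_order X DC xs"
    and Q: "Q \<in> degree_class X E DC guard" and D: "domain Q \<subseteq> {1..2 ^ b}"
    and Rs: "distinct Rs" "set Rs = relations (bin_query b Q)"
  shows "real (snd (run_wcj (bin_order b xs) (bin_query b Q) Rs))
    \<le> soft_bound 46 2 b Q
        (real (card E) * real (card X) * real (the_enat (wc (degree_class X E DC guard))))"
proof -
  define W where "W = the_enat (wc (degree_class X E DC guard))"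
  define g where "g = max 1 (real (card E) * real (card X) * real W)"
  define S where "S = real (query_size Q)"
  define P where "P = 1 + real b + log 2 (1 + real (data_size Q))"
  define t where "t = nat \<lfloor>2 + log 2 (1 + real (data_size Q))\<rfloor>"
  define r where "r = length Rs"
  define l where "l = card X * b"
  define L where "L = 1 + r + l + 2 * (1 + r * (1 + 2 * t))"
  have jq: "join_query Q" and X: "variables Q = X" and E: "scope ` relations Q = E"
    using Q by (auto simp: degree_class_def)
  have dist: "distinct xs" "set xs = X" using xs by (auto simp: compatible_order_def)
  have len: "length (bin_order b xs) = l"
    using dist distinct_card[OF dist(1)] by (simp add: length_bin_order l_def)
  let ?B = "bin_query b Q" and ?zs = "bin_order b xs"
  have jqB: "join_query ?B" using jq by (rule join_query_bin_query)
  have dB: "domain ?B = {0, 1}" by (simp add: bin_query_def)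
  have log: "log 2 (1 + real (data_size Q)) \<ge> 0" by simp
  have "snd (exec_wcj ?zs (sorted_list_of_set (domain ?B)) Map.empty (map (open_rel ?zs) Rs))
    \<le> L * (1 + card (domain ?B) * card (live ?B ([] @ ?zs) (length ([]::('v \<times> nat) list)) Map.empty))"
  proof (rule exec_wcj_time[OF jqB Rs(2), where M = "data_size Q" and t = t])
    show "distinct ([] @ ?zs)" using dist by (simp add: distinct_bin_order)
    show "Map.empty \<in> tuples (set []) (domain ?B)" by (simp add: tuples_def)
    show "list_all2 (represents ([] @ ?zs) [] Map.empty) Rs (map (open_rel ?zs) Rs)"
      by (simp add: list_all2_conv_all_nth represents_open_rel)
    show "card (tups R) \<le> data_size Q" if R: "R \<in> relations ?B" for R
    proof -
      obtain R' where R': "R' \<in> relations Q" "R = bin_rel b R'" using R by (auto simp: bin_query_def)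
      have "card (tups R) \<le> card (tups R')"
        using finite_tups[OF jq R'(1)] by (simp add: R'(2) bin_rel_def card_image_le)
      also have "\<dots> \<le> data_size Q"
        unfolding data_size_def using jq R'(1) by (intro member_le_sum) (auto simp: join_query_def)
      finally show ?thesis .
    qed
    show "snd (bsearch p lo hi) \<le> t" if "hi - lo \<le> data_size Q" for p lo hi
      using bsearch_time[OF that, of p] log unfolding t_def by linarith
    show "L = 1 + length Rs + length ([] @ ?zs) + card (domain ?B) * (1 + length Rs * (1 + 2 * t))"
      using dB len by (simp add: L_def r_def)
  qed
  also have "\<dots> \<le> L * (1 + 2 * ((l + 1) * W))"
    using card_live_le[of ?zs ?B W Map.empty] card_partial_answers_le_wc[OF dc Q D wc xs] dB len
    by (auto simp: W_def intro!: mult_left_mono)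
  finally have "snd (run_wcj ?zs ?B Rs) \<le> r + L * (1 + 2 * ((l + 1) * W))"
    by (simp add: run_wcj_def split_beta Let_def r_def)
  then have "real (snd (run_wcj ?zs ?B Rs)) \<le> real (r + L * (1 + 2 * ((l + 1) * W)))"
    by (simp only: of_nat_le_iff)
  then have run: "real (snd (run_wcj ?zs ?B Rs)) \<le> real r + real L * (1 + 2 * ((real l + 1) * real W))"
    by (simp only: of_nat_add of_nat_mult of_nat_1 of_nat_numeral)
  \<comment> \<open>Not immediate, since \<open>card E\<close> or \<open>card X\<close> could be 0.
    If \<open>X\<close> is nonempty, covering it needs a hyperedge, so both are at least 1.\<close>
  have W: "real W \<le> g"
  proof (cases "X = {}")
    case True
    then have "W \<le> 1" using wc wc_le_one_if_no_variables[of E DC guard]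
      unfolding W_def by (cases "wc (degree_class X E DC guard)") (auto simp: one_enat_def)
    then show ?thesis by (auto simp: g_def)
  next
    case False
    have "finite X" "finite E" using hg finite_subset[of E "Pow X"] by (auto simp: hypergraph_def)
    moreover have "E \<noteq> {}" using covered_if_wc_finite[OF hg dc wc] False by auto
    ultimately have "1 \<le> card E" "1 \<le> card X" using False by (auto simp: Suc_le_eq card_gt_0_iff)
    then have "1 * 1 * real W \<le> real (card E) * real (card X) * real W"
      by (intro mult_mono) auto
    then show ?thesis by (auto simp: g_def)
  qed
  have g: "1 \<le> g" by (simp add: g_def)
  have S: "1 \<le> S" "real r \<le> S" "real (card X) + 1 \<le> S"
  proof -
    have "card (relations Q) \<le> (\<Sum>R\<in>relations Q. 1 + card (scope R))"
      using sum_mono[of "relations Q" "\<lambda>_. 1::nat" "\<lambda>R. 1 + card (scope R)"] by simp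
    then have "card (relations Q) + card X + 1 \<le> query_size Q" by (simp add: query_size_def X)
    moreover have "r \<le> card (relations Q)"
      using card_relations_bin_query[OF jq, of b] Rs distinct_card[OF Rs(1)] by (simp add: r_def)
    ultimately show "1 \<le> S" "real r \<le> S" "real (card X) + 1 \<le> S" by (simp_all add: S_def)
  qed
  have P: "1 \<le> P" "real b \<le> P - 1" "real t \<le> 2 * P"
    using log by (simp_all add: P_def t_def, linarith)
  have SP: "S \<le> S * P" "1 \<le> S * P" using S P by (simp_all add: mult_ge1_I mult_le_cancel_left1)
  have l: "real l + 1 \<le> S * P"
  proof -
    \<comment> \<open>The bound by \<open>P - 1\<close> leaves one spare \<open>S\<close>, which
      absorbs the level of the empty tuple.\<close>
    have "real (card X) * real b \<le> S * (P - 1)" using S P by (simp add: l_def mult_mono)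
    then show ?thesis using S by (simp add: l_def algebra_simps)
  qed
  define y where "y = real r * (1 + 2 * real t)"
  have "y \<le> S * (5 * P)" using S P unfolding y_def by (intro mult_mono) auto
  then have "y \<le> 5 * (S * P)" by simp
  moreover have "real L = 1 + real r + real l + 2 * (1 + y)"
    by (simp add: L_def y_def algebra_simps)
  moreover have "1 + x + k + 2 * (1 + y) \<le> 15 * z"
    if "y \<le> 5 * z" "k + 1 \<le> z" "s \<le> z" "1 \<le> z" "x \<le> s" for x k y z s :: real
    using that by simp
  ultimately have L: "real L \<le> 15 * (S * P)" using l SP S(2) by metis
  have "1 + 2 * ((real l + 1) * real W) \<le> 3 * (S * P * g)"
  proof -
    have "(real l + 1) * real W \<le> S * P * g" using l W by (intro mult_mono) auto
    moreover have "1 \<le> S * P * g" using SP(2) g by (metis mult_ge1_I)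
    ultimately show ?thesis by simp
  qed
  then have "real L * (1 + 2 * ((real l + 1) * real W)) \<le> (15 * (S * P)) * (3 * (S * P * g))"
    using L SP by (intro mult_mono) auto
  moreover have "real r \<le> (S * P) * (S * P) * g"
  proof -
    have "real r \<le> S * P" using S SP by linarith
    also have "\<dots> \<le> (S * P) * ((S * P) * g)"
      using SP mult_ge1_I[OF SP(2) g] by (simp add: mult_le_cancel_left1)
    finally show ?thesis by (simp add: mult.assoc)
  qed
  ultimately have "real (snd (run_wcj ?zs ?B Rs)) \<le> 46 * ((S * P) * (S * P) * g)"
    using run by (simp add: algebra_simps)
  then show ?thesis
    by (simp add: soft_bound_def S_def P_def g_def W_def power2_eq_square algebra_simps)
qed

theorem corollary9:
  shows "\<exists>(c :: real) (k :: nat).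
    \<forall>(X :: 'v set) (E :: 'v set set) (DC :: 'v degree_constraint set)
       (guard :: 'v degree_constraint \<Rightarrow> 'v set) (xs :: 'v list)
       (b :: nat) (Q :: ('v, nat) join_query) (Rs :: ('v \<times> nat, nat) relation list).
      hypergraph X E \<longrightarrow>
      degree_constraints X E DC guard \<longrightarrow>
      wc (degree_class X E DC guard) < \<infinity> \<longrightarrow>
      acyclic (dependency_graph DC) \<longrightarrow>
      compatible_order X DC xs \<longrightarrow>
      Q \<in> degree_class X E DC guard \<longrightarrow>
      domain Q \<subseteq> {1..2 ^ b} \<longrightarrow>
      distinct Rs \<and> set Rs = relations (bin_query b Q) \<longrightarrow>
      (let out = wcj (bin_order b xs) (bin_query b Q) Map.empty;
           run = run_wcj (bin_order b xs) (bin_query b Q) Rs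
       in distinct out \<and>
          bij_betw (bin_tuple b) (ans Q) (set out) \<and>
          fst run = out \<and>
          real (snd run) \<le> soft_bound c k b Q
            (real (card E) * real (card X) * real (the_enat (wc (degree_class X E DC guard)))))"
proof (rule exI[of _ 46], rule exI[of _ 2], intro allI impI)
  fix X :: "'v set" and E :: "'v set set" and DC :: "'v degree_constraint set"
    and guard :: "'v degree_constraint \<Rightarrow> 'v set" and xs :: "'v list" and b :: nat
    and Q :: "('v, nat) join_query" and Rs :: "('v \<times> nat, nat) relation list"
  assume hg: "hypergraph X E" and dc: "degree_constraints X E DC guard"
    and wc: "wc (degree_class X E DC guard) < \<infinity>" and xs: "compatible_order X DC xs"
    and Q: "Q \<in> degree_class X E DC guard" and D: "domain Q \<subseteq> {1..2 ^ b}"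
    and Rs: "distinct Rs \<and> set Rs = relations (bin_query b Q)"
  let ?B = "bin_query b Q" and ?zs = "bin_order b xs"
  have jq: "join_query Q" and X: "variables Q = X" and E: "scope ` relations Q = E"
    using Q by (auto simp: degree_class_def)
  have dist: "distinct xs" "set xs = X" using xs by (auto simp: compatible_order_def)
  have jqB: "join_query ?B" using jq by (rule join_query_bin_query)
  have zs: "distinct ([] @ ?zs)" "set ([] @ ?zs) = variables ?B"
    using dist X by (simp_all add: distinct_bin_order set_bin_order bin_query_def)
  have "Map.empty \<in> tuples (set []) (domain ?B)" by (simp add: tuples_def)
  from wcj_correct[OF jqB zs this]
  have wcj: "distinct (wcj ?zs ?B Map.empty)" "set (wcj ?zs ?B Map.empty) = ans ?B" by simp_all
  have "ans ?B = bin_tuple b ` ans Q"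
    using ans_bin_query[OF jq D] covered_if_wc_finite[OF hg dc wc] X E by simp
  moreover have "inj_on (bin_tuple b) (ans Q)"
    using inj_on_bin_tuple[OF D] by (rule inj_on_subset) (auto simp: ans_def)
  ultimately have "bij_betw (bin_tuple b) (ans Q) (set (wcj ?zs ?B Map.empty))"
    using wcj(2) by (simp add: bij_betw_def)
  moreover have "fst (run_wcj ?zs ?B Rs) = wcj ?zs ?B Map.empty"
  proof -
    have "list_all2 (represents ([] @ ?zs) [] Map.empty) Rs (map (open_rel ?zs) Rs)"
      by (simp add: list_all2_conv_all_nth represents_open_rel)
    from exec_wcj_output[OF jqB _ zs(1) _ this]
    show ?thesis using Rs by (simp add: run_wcj_def split_beta Let_def)
  qed
  ultimately show "let out = wcj ?zs ?B Map.empty; run = run_wcj ?zs ?B Rs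
       in distinct out \<and> bij_betw (bin_tuple b) (ans Q) (set out) \<and> fst run = out \<and>
          real (snd run) \<le> soft_bound 46 2 b Q
            (real (card E) * real (card X) * real (the_enat (wc (degree_class X E DC guard))))"
    using wcj(1) run_wcj_time[OF hg dc wc xs Q D] Rs by (simp add: Let_def)
qed

end
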